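(* There is no nontrivial smooth traveling wave solution $u(t,x)=\phi(x-ct)$, $c\in\mathbb{R}$, of the equation $$m_t+(u^2-u_x^2)m_x+2u_xm^2=0,\quad m=u-u_{xx},\qquad t>0,\ x\in\mathbb{R},$$ in $C([0,\infty);H^3(\mathbb{R}))\cap C^1([0,\infty);H^2(\mathbb{R}))$. That is, if $u(t,x)=\phi(x-ct)$ belongs to this space and solves the equation, then $\phi\equiv0$.
   Context: The equation can be written as $m_t+\big((u^2-u_x^2)m\big)_x=0$, $m=u-u_{xx}$; for $u\in C([0,\infty);H^3(\mathbb{R}))\cap C^1([0,\infty);H^2(\mathbb{R}))$ the equation is understood as an identity in $L^2(\mathbb{R})$ for each $t$. *)

theory Defs
  imports "HOL-Analysis.Analysis"
begin

text \<open>Elements of the spaces \<open>L\<^sup>2(\<real>)\<close> and \<open>H\<^sup>k(\<real>)\<close> are represented by functions rather than by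
  almost-everywhere classes. Every notion below depends on a function only up to modification on a
  Lebesgue null set.\<close>

definition L2 :: "(real \<Rightarrow> real) set" where
  "L2 = {f \<in> borel_measurable lebesgue. integrable lebesgue (\<lambda>x. (f x)\<^sup>2)}"

definition L2_norm :: "(real \<Rightarrow> real) \<Rightarrow> real" where
  "L2_norm f = sqrt (LINT x|lebesgue. (f x)\<^sup>2)"

definition test_function :: "(real \<Rightarrow> real) \<Rightarrow> bool" where
  "test_function \<psi> \<longleftrightarrow>
     (\<forall>n x. ((deriv ^^ n) \<psi>) differentiable (at x)) \<and> compact (closure {x. \<psi> x \<noteq> 0})"

definition locally_integrable :: "(real \<Rightarrow> real) \<Rightarrow> bool" where
  "locally_integrable f \<longleftrightarrow> (\<forall>a b. set_integrable lebesgue {a..b} f)"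

definition is_weak_deriv :: "(real \<Rightarrow> real) \<Rightarrow> (real \<Rightarrow> real) \<Rightarrow> bool" where
  "is_weak_deriv f g \<longleftrightarrow>
     locally_integrable f \<and> locally_integrable g \<and>
     (\<forall>\<psi>. test_function \<psi> \<longrightarrow>
        (LINT x|lebesgue. f x * deriv \<psi> x) = - (LINT x|lebesgue. g x * \<psi> x))"

text \<open>A weak derivative is unique up to a null set, so the choice only selects a representative. It
  is meaningful only if a weak derivative exists; below it is used for elements of \<open>H\<^sup>k(\<real>)\<close>, at
  most \<open>k\<close> times.\<close>

definition weak_deriv :: "(real \<Rightarrow> real) \<Rightarrow> real \<Rightarrow> real" where
  "weak_deriv f = (SOME g. is_weak_deriv f g)"

primrec sobolev :: "nat \<Rightarrow> (real \<Rightarrow> real) set" where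
  "sobolev 0 = L2"
| "sobolev (Suc k) = {f \<in> L2. \<exists>g \<in> sobolev k. is_weak_deriv f g}"

definition sobolev_norm :: "nat \<Rightarrow> (real \<Rightarrow> real) \<Rightarrow> real" where
  "sobolev_norm k f = sqrt (\<Sum>j\<le>k. (L2_norm ((weak_deriv ^^ j) f))\<^sup>2)"

text \<open>The space \<open>C([0,\<infinity>); H\<^sup>k(\<real>))\<close>. Only the values \<open>u t\<close> with \<open>t \<ge> 0\<close> matter.\<close>

definition C0_sobolev :: "nat \<Rightarrow> (real \<Rightarrow> real \<Rightarrow> real) set" where
  "C0_sobolev k = {u. (\<forall>t\<ge>0. u t \<in> sobolev k) \<and>
     (\<forall>t\<ge>0. ((\<lambda>s. sobolev_norm k (\<lambda>x. u s x - u t x)) \<longlongrightarrow> 0) (at t within {0..}))}"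

text \<open>\<open>v\<close> is the time derivative, as a limit in \<open>H\<^sup>k(\<real>)\<close>, of \<open>u\<close> at \<open>t\<close> (one-sided at \<open>t = 0\<close>).\<close>

definition has_time_deriv ::
    "nat \<Rightarrow> (real \<Rightarrow> real \<Rightarrow> real) \<Rightarrow> (real \<Rightarrow> real) \<Rightarrow> real \<Rightarrow> bool" where
  "has_time_deriv k u v t \<longleftrightarrow> v \<in> sobolev k \<and>
     ((\<lambda>s. sobolev_norm k (\<lambda>x. (u s x - u t x) / (s - t) - v x)) \<longlongrightarrow> 0) (at t within {0..})"

text \<open>The space \<open>C\<^sup>1([0,\<infinity>); H\<^sup>k(\<real>))\<close>.\<close>

definition C1_sobolev :: "nat \<Rightarrow> (real \<Rightarrow> real \<Rightarrow> real) set" where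
  "C1_sobolev k = {u. (\<forall>t\<ge>0. u t \<in> sobolev k) \<and>
     (\<exists>u' \<in> C0_sobolev k. \<forall>t\<ge>0. has_time_deriv k u (u' t) t)}"

definition momentum :: "(real \<Rightarrow> real \<Rightarrow> real) \<Rightarrow> real \<Rightarrow> real \<Rightarrow> real" where
  "momentum u t x = u t x - weak_deriv (weak_deriv (u t)) x"

text \<open>The equation \<open>m\<^sub>t + (u\<^sup>2 - u\<^sub>x\<^sup>2) m\<^sub>x + 2 u\<^sub>x m\<^sup>2 = 0\<close> as an identity in \<open>L\<^sup>2(\<real>)\<close> for each
  \<open>t > 0\<close>, where \<open>m\<^sub>t\<close> is the derivative of the \<open>L\<^sup>2\<close>-valued function \<open>m\<close> (recall \<open>H\<^sup>0 = L\<^sup>2\<close>); it is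
  unique up to a null set.\<close>

definition solves_equation :: "(real \<Rightarrow> real \<Rightarrow> real) \<Rightarrow> bool" where
  "solves_equation u \<longleftrightarrow> (\<forall>t>0. \<exists>m\<^sub>t.
     has_time_deriv 0 (momentum u) m\<^sub>t t \<and>
     (AE x in lebesgue.
        m\<^sub>t x + ((u t x)\<^sup>2 - (weak_deriv (u t) x)\<^sup>2) * weak_deriv (momentum u t) x
          + 2 * weak_deriv (u t) x * (momentum u t x)\<^sup>2 = 0))"

end

theory Submission
  imports Defs
begin

text \<open>By the du Bois-Reymond lemma, \<open>\<phi>\<close>, \<open>\<phi>'\<close> and \<open>\<phi>''\<close> have representatives that are primitives
  of the respective next derivative. Integrating the difference quotient of \<open>m = \<phi> - \<phi>''\<close> over
  intervals identifies \<open>m\<^sub>t\<close> with \<open>- c m'\<close>, so with \<open>G = \<phi>\<^sup>2 - \<phi>'\<^sup>2\<close> the equation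
  integrates to \<open>(G - c) m = K\<close>. Functions in \<open>H\<^sup>1\<close> vanish at infinity, whence \<open>K = 0\<close>; since
  \<open>G' = 2 \<phi>' m\<close>, it follows that \<open>(G - c)\<^sup>2\<close> is constant, equal to \<open>c\<^sup>2\<close>. At a maximum of
  \<open>\<phi>\<^sup>2\<close> that is not zero \<open>\<phi>' = 0\<close>, hence \<open>G = 2 c > 0\<close> there, and by the intermediate value
  theorem \<open>G = c\<close> somewhere, a contradiction.\<close>

section \<open>Primitives of locally integrable functions\<close>

text \<open>For a profile in H^3 only \<open>\<phi>\<close>, \<open>\<phi>'\<close> and
  \<open>\<phi>''\<close> have continuous representatives, while \<open>\<phi>'''\<close> is merely
  square integrable. Thus \<open>m\<close> need not be differentiable at every point, and the
  equation holds only almost everywhere, so classical calculus cannot integrate it.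
  \<open>is_primitive F f\<close> takes over this role: it amounts to local absolute continuity of
  \<open>F\<close> with derivative \<open>f\<close>, phrased through the fundamental theorem of
  calculus. The relation tolerates changes of \<open>f\<close> on null sets, is stable under
  products and translations, determines \<open>f\<close> almost everywhere, and makes every
  primitive of 0 constant. These are the properties needed to integrate the equation once. What gets
  integrated is the conservation form: since \<open>G' = 2 \<phi>' m\<close>, the nonlinear terms
  \<open>G m' + 2 \<phi>' m\<^sup>2\<close> are the derivative of \<open>G m\<close>.\<close>

definition is_primitive :: "(real \<Rightarrow> real) \<Rightarrow> (real \<Rightarrow> real) \<Rightarrow> bool" where
  "is_primitive F f \<longleftrightarrow>
     locally_integrable f \<and> (\<forall>a b. a \<le> b \<longrightarrow> (f has_integral (F b - F a)) {a..b})"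

lemma locally_integrable_iff: "locally_integrable f \<longleftrightarrow> (\<forall>a b. f absolutely_integrable_on {a..b})"
  by (simp add: locally_integrable_def)

lemma locally_integrable_imp_integrable_on: "locally_integrable f \<Longrightarrow> f integrable_on {a..b}"
  by (simp add: locally_integrable_iff absolutely_integrable_on_def)

lemma AE_lebesgue_negligible:
  assumes "AE x in lebesgue. P x"
  obtains N where "negligible N" "\<And>x. x \<notin> N \<Longrightarrow> P x"
proof -
  from assms obtain N where "N \<in> null_sets lebesgue" "{x. \<not> P x} \<subseteq> N"
    unfolding eventually_ae_filter by force
  then show thesis
    using that[of N] by (auto simp: negligible_iff_null_sets)
qed

lemma locally_integrable_AE_cong:
  assumes "locally_integrable f" "AE x in lebesgue. f x = g x"
  shows "locally_integrable g"
proof -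
  obtain N where N: "negligible N" "\<And>x. x \<notin> N \<Longrightarrow> f x = g x"
    using AE_lebesgue_negligible[OF assms(2)] by blast
  show ?thesis
    unfolding locally_integrable_iff
  proof (intro allI)
    fix a b
    show "g absolutely_integrable_on {a..b}"
      by (rule absolutely_integrable_spike[where f = f and S = N])
        (use assms(1) N in \<open>auto simp: locally_integrable_iff\<close>)
  qed
qed

lemma is_primitive_AE_cong:
  assumes "is_primitive F f" "AE x in lebesgue. f x = g x"
  shows "is_primitive F g"
proof -
  obtain N where N: "negligible N" "\<And>x. x \<notin> N \<Longrightarrow> f x = g x"
    using AE_lebesgue_negligible[OF assms(2)] by blast
  have "(g has_integral (F b - F a)) {a..b}" if "a \<le> b" for a b
    by (rule has_integral_spike[where f = f and S = N])
      (use assms(1) that N in \<open>auto simp: is_primitive_def\<close>)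
  then show ?thesis
    using assms(1) locally_integrable_AE_cong[OF _ assms(2)] by (simp add: is_primitive_def)
qed

lemma is_primitive_integral: "is_primitive F f \<Longrightarrow> a \<le> b \<Longrightarrow> integral {a..b} f = F b - F a"
  by (auto simp: is_primitive_def intro: integral_unique)

lemma is_primitiveI:
  assumes "locally_integrable f" "\<And>a b. a \<le> b \<Longrightarrow> integral {a..b} f = F b - F a"
  shows "is_primitive F f"
  unfolding is_primitive_def
proof (intro conjI allI impI assms(1))
  fix a b :: real assume "a \<le> b"
  show "(f has_integral F b - F a) {a..b}"
    using integrable_integral[OF locally_integrable_imp_integrable_on[OF assms(1), of a b]]
    by (simp add: assms(2)[OF \<open>a \<le> b\<close>])
qed

lemma ex_primitive:
  assumes "locally_integrable f"
  shows "\<exists>F. is_primitive F f"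
proof -
  note i = locally_integrable_imp_integrable_on[OF assms]
  \<comment> \<open>An integral over \<open>{0..x}\<close> is 0 for negative \<open>x\<close>, so
    the oriented integral from 0 has to be spelled out.\<close>
  define F where "F x = (if 0 \<le> x then integral {0..x} f else - integral {x..0} f)" for x
  have "integral {a..b} f = F b - F a" if "a \<le> b" for a b
  proof -
    consider "0 \<le> a" | "a < 0" "0 \<le> b" | "b < 0" by linarith
    then show ?thesis
    proof cases
      case 1
      then show ?thesis
        using Henstock_Kurzweil_Integration.integral_combine[of 0 a b f] i that by (simp add: F_def)
    next
      case 2
      then show ?thesis
        using Henstock_Kurzweil_Integration.integral_combine[of a 0 b f] i that by (simp add: F_def)
    next
      case 3
      then show ?thesis
        using Henstock_Kurzweil_Integration.integral_combine[of a b 0 f] i that by (simp add: F_def)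
    qed
  qed
  then have "is_primitive F f"
    by (intro is_primitiveI assms)
  then show ?thesis by blast
qed

section \<open>Continuity, linear operations and classical derivatives\<close>

lemma is_primitive_isCont:
  assumes "is_primitive F f"
  shows "isCont F x"
proof -
  have i: "f integrable_on {x-1..x+1}"
    using assms by (simp add: is_primitive_def locally_integrable_imp_integrable_on)
  have "continuous_on {x-1..x+1} (\<lambda>y. F (x-1) + integral {x-1..y} f)"
    by (intro continuous_intros indefinite_integral_continuous_1 i)
  then have "continuous_on {x-1..x+1} F"
    by (rule continuous_on_eq) (use is_primitive_integral[OF assms] in auto)
  then show ?thesis
    by (rule continuous_on_interior) auto
qed

lemma is_primitive_continuous_on: "is_primitive F f \<Longrightarrow> continuous_on S F"
  by (simp add: is_primitive_isCont continuous_at_imp_continuous_on)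

lemma is_primitive_const: "is_primitive (\<lambda>x. k) (\<lambda>x. 0)"
  by (auto simp: is_primitive_def locally_integrable_def)

lemma is_primitive_diff:
  assumes "is_primitive F f" "is_primitive G g"
  shows "is_primitive (\<lambda>x. F x - G x) (\<lambda>x. f x - g x)"
  unfolding is_primitive_def
proof (intro conjI allI impI)
  show "locally_integrable (\<lambda>x. f x - g x)"
    using assms unfolding is_primitive_def locally_integrable_def
    by (auto intro: set_integral_diff)
  fix a b :: real assume "a \<le> b"
  then have "((\<lambda>x. f x - g x) has_integral (F b - F a) - (G b - G a)) {a..b}"
    using assms by (intro has_integral_diff) (auto simp: is_primitive_def)
  then show "((\<lambda>x. f x - g x) has_integral (F b - G b) - (F a - G a)) {a..b}"
    by (simp add: algebra_simps)
qed

lemma is_primitive_cmult: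
  assumes "is_primitive F f"
  shows "is_primitive (\<lambda>x. k * F x) (\<lambda>x. k * f x)"
  unfolding is_primitive_def
proof (intro conjI allI impI)
  show "locally_integrable (\<lambda>x. k * f x)"
    using assms unfolding is_primitive_def locally_integrable_def by auto
  fix a b :: real assume "a \<le> b"
  then have "((\<lambda>x. k * f x) has_integral k * (F b - F a)) {a..b}"
    using assms by (intro has_integral_mult_right) (auto simp: is_primitive_def)
  then show "((\<lambda>x. k * f x) has_integral k * F b - k * F a) {a..b}"
    by (simp add: algebra_simps)
qed

lemma is_primitive_add:
  assumes "is_primitive F f" "is_primitive G g"
  shows "is_primitive (\<lambda>x. F x + G x) (\<lambda>x. f x + g x)"
  using is_primitive_diff[OF assms(1) is_primitive_cmult[OF assms(2), of "-1"]] by simp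

lemma is_primitive_shift:
  assumes "is_primitive F f"
  shows "is_primitive (\<lambda>x. F (x - d)) (\<lambda>x. f (x - d))"
  unfolding is_primitive_def
proof (intro conjI allI impI)
  have shift: "((\<lambda>x. g (x - d)) has_integral i) {a..b}"
    if "(g has_integral i) {a - d..b - d}" for a b i and g :: "real \<Rightarrow> real"
    using has_integral_affinity[of g i "a-d" "b-d" 1 "-d"] that by simp
  have "(\<lambda>x. f (x - d)) absolutely_integrable_on {a..b}" for a b
  proof -
    have "f absolutely_integrable_on {a-d..b-d}"
      using assms by (auto simp: is_primitive_def locally_integrable_iff)
    then show ?thesis
      using shift[of f _ a b] shift[of "\<lambda>x. norm (f x)" _ a b]
      unfolding absolutely_integrable_on_def integrable_on_def by blast
  qed
  then show "locally_integrable (\<lambda>x. f (x - d))"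
    by (simp add: locally_integrable_iff)
  fix a b :: real assume "a \<le> b"
  then show "((\<lambda>x. f (x - d)) has_integral F (b - d) - F (a - d)) {a..b}"
    using assms by (intro shift) (simp add: is_primitive_def)
qed

lemma is_primitive_deriv:
  assumes "is_primitive F f" "continuous_on UNIV f"
  shows "(F has_field_derivative f x) (at x)"
proof -
  have c: "continuous_on {x-1..x+1} f"
    using assms(2) continuous_on_subset by blast
  have "((\<lambda>y. integral {x-1..y} f) has_real_derivative f x) (at x within {x-1..x+1})"
    by (rule integral_has_real_derivative[OF c]) auto
  then have "((\<lambda>y. integral {x-1..y} f) has_real_derivative f x) (at x)"
    using at_within_interior[of x "{x-1..x+1}"] by simp
  then have "((\<lambda>y. F (x-1) + integral {x-1..y} f) has_real_derivative f x) (at x)"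
    by (auto intro!: derivative_eq_intros)
  then show ?thesis
    by (rule has_field_derivative_transform_within_open[of _ _ _ "{x-1<..<x+1}"])
       (use is_primitive_integral[OF assms(1)] in auto)
qed

lemma is_primitive_if_deriv:
  assumes "\<And>x. (F has_field_derivative f x) (at x)" "continuous_on UNIV f"
  shows "is_primitive F f"
  unfolding is_primitive_def locally_integrable_iff
proof (intro conjI allI impI)
  fix a b :: real
  show "f absolutely_integrable_on {a..b}"
    by (rule absolutely_integrable_continuous_real) (use assms(2) continuous_on_subset in blast)
  assume "a \<le> b"
  then show "(f has_integral F b - F a) {a..b}"
    using assms(1)
    by (intro fundamental_theorem_of_calculus)
       (auto simp: has_real_derivative_iff_has_vector_derivative[symmetric] intro: has_field_derivative_at_within)
qed

section \<open>Products of primitives\<close>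

lemma locally_integrable_continuous_mult:
  assumes "locally_integrable f" "continuous_on UNIV G"
  shows "locally_integrable (\<lambda>x. G x * f x)"
  unfolding locally_integrable_iff
proof (intro allI)
  fix a b :: real
  have c: "continuous_on {a..b} G" using assms(2) continuous_on_subset by blast
  show "(\<lambda>x. G x * f x) absolutely_integrable_on {a..b}"
  proof (rule absolutely_integrable_bounded_measurable_product_real)
    show "G \<in> borel_measurable (lebesgue_on {a..b})"
      by (rule continuous_imp_measurable_on_sets_lebesgue[OF c]) auto
    show "bounded (G ` {a..b})"
      by (intro compact_imp_bounded compact_continuous_image c) auto
  qed (use assms(1) in \<open>auto simp: locally_integrable_iff\<close>)
qed

lemma locally_integrable_add:
  "locally_integrable f \<Longrightarrow> locally_integrable g \<Longrightarrow> locally_integrable (\<lambda>x. f x + g x)"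
  unfolding locally_integrable_def by (auto intro: set_integral_add)

text \<open>On a short interval \<open>[p, q]\<close> the defect of the product formula is at most \<open>e\<close> times the
  integral of \<open>\<bar>f\<bar> + \<bar>g\<bar>\<close>; such a bound is additive in the interval, so it holds globally.\<close>

lemma is_primitive_mult:
  assumes F: "is_primitive F f" and G: "is_primitive G g"
  shows "is_primitive (\<lambda>x. F x * G x) (\<lambda>x. F x * g x + f x * G x)" (is "is_primitive _ ?h")
proof -
  have li: "locally_integrable f" "locally_integrable g"
    using assms by (auto simp: is_primitive_def)
  have "locally_integrable (\<lambda>x. F x * g x)" "locally_integrable (\<lambda>x. G x * f x)"
    using li assms is_primitive_continuous_on by (auto intro!: locally_integrable_continuous_mult)
  then have lih: "locally_integrable ?h"
    using locally_integrable_add[of "\<lambda>x. F x * g x" "\<lambda>x. G x * f x"] by (simp add: mult.commute)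
  have lin: "locally_integrable (\<lambda>x. \<bar>f x\<bar> + \<bar>g x\<bar>)"
    using li by (intro locally_integrable_add) (auto simp: locally_integrable_def intro: set_integrable_abs)
  note i = locally_integrable_imp_integrable_on
  have "integral {a..b} ?h = F b * G b - F a * G a" if ab: "a \<le> b" for a b
  proof -
    have "\<bar>F b * G b - F a * G a - integral {a..b} ?h\<bar> \<le> e * integral {a..b} (\<lambda>x. \<bar>f x\<bar> + \<bar>g x\<bar>)"
      (is "?P a b") if "e > 0" for e
    proof (rule Bolzano[where P = ?P])
      show "a \<le> b" by fact
    next
      fix p q r :: real
      assume trans: "?P p q" "?P q r" "p \<le> q" "q \<le> r"
      have "integral {p..r} ?h = integral {p..q} ?h + integral {q..r} ?h"
        "integral {p..r} (\<lambda>x. \<bar>f x\<bar> + \<bar>g x\<bar>)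
          = integral {p..q} (\<lambda>x. \<bar>f x\<bar> + \<bar>g x\<bar>) + integral {q..r} (\<lambda>x. \<bar>f x\<bar> + \<bar>g x\<bar>)"
        using trans(3,4) i[OF lih] i[OF lin]
        by (simp_all add: Henstock_Kurzweil_Integration.integral_combine)
      with trans(1,2) show "?P p r"
        by (simp add: distrib_left)
    next
      fix x :: real
      have "isCont F x" "isCont G x"
        using assms is_primitive_isCont by auto
      obtain d1 where "d1 > 0" and d1: "\<And>y. \<bar>y - x\<bar> < d1 \<Longrightarrow> \<bar>F y - F x\<bar> < e/2"
        using \<open>isCont F x\<close> half_gt_zero[OF \<open>e > 0\<close>]
        unfolding continuous_at_eps_delta dist_real_def by blast
      obtain d2 where "d2 > 0" and d2: "\<And>y. \<bar>y - x\<bar> < d2 \<Longrightarrow> \<bar>G y - G x\<bar> < e/2"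
        using \<open>isCont G x\<close> half_gt_zero[OF \<open>e > 0\<close>]
        unfolding continuous_at_eps_delta dist_real_def by blast
      show "\<exists>d>0. \<forall>p q. p \<le> x \<and> x \<le> q \<and> q - p < d \<longrightarrow> ?P p q"
      proof (intro exI[of _ "min d1 d2"] conjI allI impI)
        show "0 < min d1 d2" using \<open>d1 > 0\<close> \<open>d2 > 0\<close> by simp
        fix p q assume pq: "p \<le> x \<and> x \<le> q \<and> q - p < min d1 d2"
        then have "p \<le> q" by simp
        \<comment> \<open>\<open>F\<close> is frozen at the right end and \<open>G\<close> at the
          left end. Then \<open>F q * (G q - G p) + (F q - F p) * G p\<close> is exactly the
          increment of the product, and only oscillations of \<open>F\<close> and \<open>G\<close>
          on the short interval remain in the defect.\<close>
        have "((\<lambda>s. F q * g s) has_integral F q * (G q - G p)) {p..q}"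
          using G \<open>p \<le> q\<close> by (intro has_integral_mult_right) (auto simp: is_primitive_def)
        moreover have "((\<lambda>s. f s * G p) has_integral (F q - F p) * G p) {p..q}"
          using F \<open>p \<le> q\<close> by (intro has_integral_mult_left) (auto simp: is_primitive_def)
        moreover have "(?h has_integral integral {p..q} ?h) {p..q}"
          using i[OF lih] by blast
        ultimately have "((\<lambda>s. F q * g s + f s * G p - ?h s) has_integral
            F q * (G q - G p) + (F q - F p) * G p - integral {p..q} ?h) {p..q}"
          by (intro has_integral_diff has_integral_add)
        then have *: "((\<lambda>s. F q * g s + f s * G p - ?h s) has_integral
            F q * G q - F p * G p - integral {p..q} ?h) {p..q}"
          by (simp add: algebra_simps)
        have "norm (integral {p..q} (\<lambda>s. F q * g s + f s * G p - ?h s))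
            \<le> integral {p..q} (\<lambda>s. e * (\<bar>f s\<bar> + \<bar>g s\<bar>))"
        proof (rule integral_norm_bound_integral)
          show "(\<lambda>s. F q * g s + f s * G p - ?h s) integrable_on {p..q}"
            using * by blast
          show "(\<lambda>s. e * (\<bar>f s\<bar> + \<bar>g s\<bar>)) integrable_on {p..q}"
            using i[OF lin] by (intro integrable_on_mult_right)
          fix s assume s: "s \<in> {p..q}"
          have "\<bar>q - x\<bar> < d1" "\<bar>s - x\<bar> < d1" "\<bar>p - x\<bar> < d2" "\<bar>s - x\<bar> < d2"
            using s pq by auto
          then have "\<bar>F q - F x\<bar> < e/2" "\<bar>F s - F x\<bar> < e/2"
            "\<bar>G p - G x\<bar> < e/2" "\<bar>G s - G x\<bar> < e/2"
            by (simp_all only: d1 d2)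
          then have "\<bar>F q - F s\<bar> \<le> e" "\<bar>G p - G s\<bar> \<le> e"
            by linarith+
          then have "\<bar>F q - F s\<bar> * \<bar>g s\<bar> + \<bar>G p - G s\<bar> * \<bar>f s\<bar> \<le> e * \<bar>g s\<bar> + e * \<bar>f s\<bar>"
            by (intro add_mono mult_right_mono) auto
          moreover have "F q * g s + f s * G p - ?h s = (F q - F s) * g s + (G p - G s) * f s"
            by (simp add: algebra_simps)
          moreover have "\<bar>(F q - F s) * g s + (G p - G s) * f s\<bar>
              \<le> \<bar>F q - F s\<bar> * \<bar>g s\<bar> + \<bar>G p - G s\<bar> * \<bar>f s\<bar>"
            by (metis abs_mult abs_triangle_ineq)
          ultimately show "norm (F q * g s + f s * G p - ?h s) \<le> e * (\<bar>f s\<bar> + \<bar>g s\<bar>)"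
            unfolding real_norm_def distrib_left by linarith
        qed
        then show "\<bar>F q * G q - F p * G p - integral {p..q} ?h\<bar>
            \<le> e * integral {p..q} (\<lambda>x. \<bar>f x\<bar> + \<bar>g x\<bar>)"
          using integral_unique[OF *] by simp
      qed
    qed
    then have "\<bar>F b * G b - F a * G a - integral {a..b} ?h\<bar> \<le> 0"
    proof -
      assume *: "\<And>e. e > 0 \<Longrightarrow> \<bar>F b * G b - F a * G a - integral {a..b} ?h\<bar>
          \<le> e * integral {a..b} (\<lambda>x. \<bar>f x\<bar> + \<bar>g x\<bar>)"
      define J where "J = integral {a..b} (\<lambda>x. \<bar>f x\<bar> + \<bar>g x\<bar>)"
      have J: "J \<ge> 0" unfolding J_def by (intro integral_nonneg i lin) auto
      show ?thesis
      proof (rule field_le_epsilon)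
        fix e :: real assume "e > 0"
        \<comment> \<open>The denominator is \<open>J + 1\<close> because \<open>J\<close> may
          vanish.\<close>
        then have "e / (J+1) > 0" "e / (J+1) * J \<le> e" using J by (simp_all add: field_simps)
        then show "\<bar>F b * G b - F a * G a - integral {a..b} ?h\<bar> \<le> 0 + e"
          using *[of "e/(J+1)"] unfolding J_def[symmetric] by linarith
      qed
    qed
    then show ?thesis by simp
  qed
  then show ?thesis
    by (intro is_primitiveI lih)
qed


section \<open>Smooth step functions\<close>

definition smooth :: "(real \<Rightarrow> real) \<Rightarrow> bool" where
  "smooth f \<longleftrightarrow> (\<forall>n x. ((deriv ^^ n) f) differentiable (at x))"

lemma deriv_eqI: "(\<And>x. (f has_field_derivative g x) (at x)) \<Longrightarrow> deriv f = g"
  by (rule ext) (rule DERIV_imp_deriv)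

text \<open>By induction all iterated derivatives stay in \<open>A\<close>, so smoothness follows
  without any formula for the n-th derivative.\<close>

lemma smooth_coinduct:
  assumes "f \<in> A" "\<And>f. f \<in> A \<Longrightarrow> \<exists>g\<in>A. \<forall>x. (f has_field_derivative g x) (at x)"
  shows "smooth f"
proof -
  have "(deriv ^^ n) f \<in> A" for n
  proof (induction n)
    case (Suc n)
    then obtain g where "g \<in> A" "\<forall>x. ((deriv ^^ n) f has_field_derivative g x) (at x)"
      using assms(2) by blast
    then show ?case
      using deriv_eqI[of "(deriv ^^ n) f" g] by simp
  qed (simp add: assms(1))
  then show ?thesis
    unfolding smooth_def using assms(2) real_differentiable_def by blast
qed

lemma smooth_imp_deriv:
  assumes "smooth f"
  shows "(f has_field_derivative deriv f x) (at x)" "smooth (deriv f)"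
proof -
  have "((deriv ^^ 0) f) differentiable (at x)"
    using assms unfolding smooth_def by blast
  then show "(f has_field_derivative deriv f x) (at x)"
    by (simp add: DERIV_deriv_iff_real_differentiable)
  have "((deriv ^^ n) (deriv f)) = (deriv ^^ Suc n) f" for n
    by (simp add: funpow_swap1)
  then show "smooth (deriv f)"
    using assms unfolding smooth_def by metis
qed

lemma smooth_antiderivative:
  assumes "\<And>x. (F has_field_derivative f x) (at x)" "smooth f"
  shows "smooth F"
proof (rule smooth_coinduct[of F "insert F {f. smooth f}"])
  fix g assume "g \<in> insert F {f. smooth f}"
  then show "\<exists>h\<in>insert F {f. smooth f}. \<forall>x. (g has_field_derivative h x) (at x)"
    using assms smooth_imp_deriv by blast
qed simp

lemma smooth_diff:
  assumes "smooth f" "smooth g"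
  shows "smooth (\<lambda>x. f x - g x)"
proof (rule smooth_coinduct[of _ "{\<lambda>x. f x - g x |f g. smooth f \<and> smooth g}"])
  fix h assume "h \<in> {\<lambda>x. f x - g x |f g. smooth f \<and> smooth g}"
  then obtain f g where fg: "smooth f" "smooth g" "h = (\<lambda>x. f x - g x)" by blast
  show "\<exists>k\<in>{\<lambda>x. f x - g x |f g. smooth f \<and> smooth g}. \<forall>x. (h has_field_derivative k x) (at x)"
  proof (intro bexI allI)
    show "(h has_field_derivative deriv f x - deriv g x) (at x)" for x
      unfolding fg(3) using fg(1,2) by (intro DERIV_diff smooth_imp_deriv)
    show "(\<lambda>x. deriv f x - deriv g x) \<in> {\<lambda>x. f x - g x |f g. smooth f \<and> smooth g}"
      using fg smooth_imp_deriv(2) by (intro CollectI exI[of _ "deriv f"] exI[of _ "deriv g"]) simp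
  qed
qed (use assms in blast)

lemma smooth_affine:
  assumes "smooth f"
  shows "smooth (\<lambda>x. k * f (n * x + d))"
proof (rule smooth_coinduct[of _ "{\<lambda>x. k * f (n * x + d) |k f. smooth f}"])
  fix h assume "h \<in> {\<lambda>x. k * f (n * x + d) |k f. smooth f}"
  then obtain k f where fg: "smooth f" "h = (\<lambda>x. k * f (n * x + d))" by blast
  have "(h has_field_derivative (k * n) * deriv f (n * x + d)) (at x)" for x
    unfolding fg(2)
    by (rule derivative_eq_intros DERIV_chain2[OF smooth_imp_deriv(1)[OF fg(1)]] refl | simp)+
  then show "\<exists>k\<in>{\<lambda>x. k * f (n * x + d) |k f. smooth f}. \<forall>x. (h has_field_derivative k x) (at x)"
    using smooth_imp_deriv(2)[OF fg(1)]
    by (intro bexI[of _ "\<lambda>x. (k * n) * deriv f (n * x + d)"] CollectI exI[of _ "k * n"] exI[of _ "deriv f"])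
       simp_all
qed (use assms in blast)

text \<open>This family contains the bump function \<open>exp (- 1 / w)\<close>, \<open>w = x (1 - x)\<close>, and is closed under
  differentiation, which yields smoothness by coinduction.\<close>

definition bump_term :: "real poly \<Rightarrow> nat \<Rightarrow> real \<Rightarrow> real" where
  "bump_term p k x =
     (if 0 < x \<and> x < 1 then poly p x * exp (- inverse (x * (1 - x))) * inverse (x * (1 - x)) ^ k else 0)"

text \<open>A single term of the exponential series is at most its sum.\<close>

lemma exp_minus_times_power_le:
  fixes t :: real
  assumes "t \<ge> 0"
  shows "exp (- t) * t ^ m \<le> fact m"
proof -
  have sums: "(\<lambda>n. t ^ n /\<^sub>R fact n) sums exp t" by (rule exp_converges)
  have "(\<Sum>n\<in>{m}. t ^ n /\<^sub>R fact n) \<le> (\<Sum>n. t ^ n /\<^sub>R fact n)"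
    using assms by (intro sum_le_suminf sums_summable[OF sums]) auto
  then have "t ^ m / fact m \<le> exp t"
    using sums_unique[OF sums] by (simp add: divide_inverse mult.commute)
  then show ?thesis
    by (simp add: exp_minus field_simps)
qed

text \<open>The exponential beats every power of \<open>1 / w\<close>. Applying this to the power
  \<open>k + 2\<close> leaves the factor \<open>w\<^sup>2\<close>, and this quadratic decay forces
  the derivative 0 at both ends of the unit interval.\<close>

lemma bump_term_bound: "\<exists>C\<ge>0. \<forall>x. 0 < x \<longrightarrow> x < 1 \<longrightarrow> \<bar>bump_term p k x\<bar> \<le> C * (x * (1 - x))\<^sup>2"
proof -
  have "compact (poly p ` {0..1})"
    by (intro compact_continuous_image continuous_intros) auto
  then obtain B where B: "\<And>x. x \<in> {0..1} \<Longrightarrow> \<bar>poly p x\<bar> \<le> B"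
    using compact_imp_bounded by (fastforce simp: bounded_iff)
  have "B \<ge> 0" using B[of 0] by fastforce
  have "\<bar>bump_term p k x\<bar> \<le> (B * fact (k + 2)) * (x * (1 - x))\<^sup>2" if x: "0 < x" "x < 1" for x
  proof -
    define w where "w = x * (1 - x)"
    have w: "w > 0" using x by (simp add: w_def)
    have "exp (- inverse w) * inverse w ^ k = exp (- inverse w) * inverse w ^ (k + 2) * w\<^sup>2"
      using w by (simp add: power_add power2_eq_square field_simps)
    also have "\<dots> \<le> fact (k + 2) * w\<^sup>2"
      using w by (intro mult_right_mono exp_minus_times_power_le) auto
    finally have e: "exp (- inverse w) * inverse w ^ k \<le> fact (k + 2) * w\<^sup>2" .
    have "\<bar>bump_term p k x\<bar> = \<bar>poly p x\<bar> * (exp (- inverse w) * inverse w ^ k)"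
      using x w by (simp add: bump_term_def abs_mult flip: w_def)
    also have "\<dots> \<le> B * (fact (k + 2) * w\<^sup>2)"
      using x w \<open>B \<ge> 0\<close> by (intro mult_mono B e) auto
    finally show ?thesis by (simp add: w_def)
  qed
  with \<open>B \<ge> 0\<close> show ?thesis by (intro exI[of _ "B * fact (k + 2)"]) auto
qed

lemma DERIV_zero_quadratic:
  fixes f :: "real \<Rightarrow> real"
  assumes "\<And>x. \<bar>f x - f y\<bar> \<le> C * (x - y)\<^sup>2"
  shows "(f has_field_derivative 0) (at y)"
  unfolding has_field_derivative_iff
proof (rule Lim_null_comparison)
  show "\<forall>\<^sub>F x in at y. norm ((f x - f y) / (x - y)) \<le> C * \<bar>x - y\<bar>"
  proof (rule eventually_at_filter[THEN iffD2], rule always_eventually, intro allI impI)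
    fix x assume "x \<noteq> y"
    then show "norm ((f x - f y) / (x - y)) \<le> C * \<bar>x - y\<bar>"
      using assms[of x] by (simp add: power2_eq_square divide_simps abs_mult_self_eq mult.assoc flip: abs_mult)
  qed
  have "((\<lambda>x. C * \<bar>x - y\<bar>) \<longlongrightarrow> C * \<bar>y - y\<bar>) (at y)"
    by (intro tendsto_intros)
  then show "((\<lambda>x. C * \<bar>x - y\<bar>) \<longlongrightarrow> 0) (at y)" by simp
qed

lemma bump_term_deriv: "\<exists>q l. \<forall>x. (bump_term p k has_field_derivative bump_term q l x) (at x)"
proof -
  define W :: "real poly" where "W = [:0, 1, - 1:]"
  have W: "poly W x = x * (1 - x)" "poly (pderiv W) x = 1 - 2 * x" for x
    by (simp_all add: W_def pderiv_pCons algebra_simps)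
  \<comment> \<open>With \<open>v = 1 / w\<close>, the product rule multiplies the common factor
    \<open>exp (- v) * v ^ k\<close> by \<open>p' + p w' v\<^sup>2 - k p w' v\<close>. Pulling out
    \<open>v\<^sup>2\<close> and using \<open>w v = 1\<close> leaves this polynomial, whence the new
    exponent \<open>k + 2\<close>.\<close>
  define q where "q = pderiv p * W ^ 2 - smult (of_nat k) (p * pderiv W * W) + p * pderiv W"
  have "(bump_term p k has_field_derivative bump_term q (k + 2) x) (at x)" for x
  proof (cases "0 < x \<and> x < 1")
    case True
    define w where "w = x * (1 - x)"
    have w: "w > 0" using True by (simp add: w_def)
    define v where "v = inverse w"
    have v: "w * v = 1" using w by (simp add: v_def)
    have dw: "((\<lambda>x. x * (1 - x)) has_field_derivative 1 - 2 * x) (at x)"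
      by (auto intro!: derivative_eq_intros)
    have dv: "((\<lambda>x. inverse (x * (1 - x))) has_field_derivative - (v * (1 - 2 * x) * v)) (at x)"
      using DERIV_inverse'[OF dw] w[unfolded w_def] unfolding v_def w_def by fastforce
    have "((\<lambda>x. poly p x * exp (- inverse (x * (1 - x))) * inverse (x * (1 - x)) ^ k) has_field_derivative
        (poly (pderiv p) x * exp (- v) + exp (- v) * (v * (1 - 2 * x) * v) * poly p x) * v ^ k
          + of_nat k * (- (v * (1 - 2 * x) * v) * v ^ (k - 1)) * (poly p x * exp (- v))) (at x)"
      using DERIV_mult[OF DERIV_mult[OF poly_DERIV[of p x] DERIV_chain2[OF DERIV_exp DERIV_minus[OF dv]]]
          DERIV_power[OF dv, where n = k]]
      by (simp add: v_def w_def)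
    also have "(poly (pderiv p) x * exp (- v) + exp (- v) * (v * (1 - 2 * x) * v) * poly p x) * v ^ k
          + of_nat k * (- (v * (1 - 2 * x) * v) * v ^ (k - 1)) * (poly p x * exp (- v))
        = poly q x * exp (- v) * v ^ (k + 2)"
    \<comment> \<open>The power rule produces \<open>k - 1\<close>, which is truncated for
      \<open>k = 0\<close>; there the factor \<open>of_nat k\<close> removes the term.\<close>
    proof (cases k)
      case 0
      show ?thesis unfolding q_def using v by (simp add: W 0 flip: w_def) algebra
    next
      case (Suc j)
      define vj where "vj = v ^ j"
      show ?thesis unfolding q_def using v by (simp add: W Suc flip: w_def vj_def) algebra
    qed
    also have "\<dots> = bump_term q (k + 2) x"
      using True by (simp add: bump_term_def w_def v_def)
    finally have "((\<lambda>x. poly p x * exp (- inverse (x * (1 - x))) * inverse (x * (1 - x)) ^ k) has_field_derivative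
      bump_term q (k + 2) x) (at x)" .
    then show ?thesis
      by (rule has_field_derivative_transform_within_open[of _ _ _ "{0<..<1}"])
         (use True in \<open>auto simp: bump_term_def\<close>)
  next
    case False
    obtain C where C: "C \<ge> 0" "\<And>x. 0 < x \<Longrightarrow> x < 1 \<Longrightarrow> \<bar>bump_term p k x\<bar> \<le> C * (x * (1 - x))\<^sup>2"
      using bump_term_bound by blast
    \<comment> \<open>For \<open>y\<close> inside the unit interval, \<open>y * (1 - y)\<close> is
      at most the distance from \<open>y\<close> to either end, hence to the outside point
      \<open>x\<close>, where the function vanishes.\<close>
    have "\<bar>bump_term p k y - bump_term p k x\<bar> \<le> C * (y - x)\<^sup>2" for y
    proof (cases "0 < y \<and> y < 1")
      case True
      have "y * (1 - y) \<le> y" "y * (1 - y) \<le> 1 - y"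
        using True by (auto simp: mult_le_cancel_left1 mult_le_cancel_right1)
      then have "y * (1 - y) \<le> \<bar>y - x\<bar>" using False by linarith
      then have "(y * (1 - y))\<^sup>2 \<le> (y - x)\<^sup>2"
        using power_mono[of "y * (1 - y)" "\<bar>y - x\<bar>" 2] True by simp
      then have "C * (y * (1 - y))\<^sup>2 \<le> C * (y - x)\<^sup>2"
        using C(1) mult_left_mono by blast
      moreover have "bump_term p k x = 0" using False by (auto simp: bump_term_def)
      ultimately show ?thesis using C(2)[of y] True by simp
    next
      case F: False
      then show ?thesis using False C(1) by (auto simp: bump_term_def)
    qed
    then have "(bump_term p k has_field_derivative 0) (at x)"
      by (rule DERIV_zero_quadratic)
    moreover have "bump_term q (k + 2) x = 0" using False by (auto simp: bump_term_def)
    ultimately show ?thesis by simp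
  qed
  then show ?thesis by blast
qed

lemma smooth_bump_term: "smooth (bump_term p k)"
proof (rule smooth_coinduct[of _ "{bump_term p k |p k. True}"])
  fix f assume "f \<in> {bump_term p k |p k. True}"
  then show "\<exists>g\<in>{bump_term p k |p k. True}. \<forall>x. (f has_field_derivative g x) (at x)"
    using bump_term_deriv by blast
qed blast

section \<open>From the bump function to smooth steps and ramps\<close>

lemma continuous_ex_antiderivative:
  fixes f :: "real \<Rightarrow> real"
  assumes "\<And>x. isCont f x"
  shows "\<exists>F. \<forall>x. (F has_field_derivative f x) (at x)"
  using einterval_antiderivative[of "-\<infinity>" "\<infinity>" f] assms
  by (auto simp: has_real_derivative_iff_has_vector_derivative)

lemma smooth_ex_antiderivative:
  assumes "smooth f"
  obtains F where "\<And>x. (F has_field_derivative f x) (at x)" "smooth F"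
  using continuous_ex_antiderivative[of f] smooth_imp_deriv(1)[OF assms] smooth_antiderivative[OF _ assms]
  by (meson DERIV_isCont)

text \<open>The step is an antiderivative of the bump, normalized to rise from 0 to 1; it is
  constant wherever the bump vanishes.\<close>

lemma ex_smooth_step:
  obtains S where "smooth S" "\<And>x. x \<le> 0 \<Longrightarrow> S x = 0" "\<And>x. x \<ge> 1 \<Longrightarrow> S x = 1"
    "\<And>x. 0 \<le> S x" "\<And>x. S x \<le> (1::real)"
proof -
  define b where "b = bump_term 1 0"
  have b: "b x = 0" if "x \<le> 0 \<or> x \<ge> 1" for x
    using that by (auto simp: b_def bump_term_def)
  have bpos: "b x > 0" if "0 < x" "x < 1" for x
    using that by (auto simp: b_def bump_term_def)
  have b0: "b x \<ge> 0" for x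
    using b[of x] bpos[of x] by linarith
  obtain F where F: "\<And>x. (F has_field_derivative b x) (at x)" "smooth F"
    using smooth_ex_antiderivative[of b] smooth_bump_term b_def by metis
  have contF: "continuous_on A F" for A
    using F(1) by (intro continuous_at_imp_continuous_on ballI) (rule DERIV_isCont)
  have mono: "F x \<le> F y" if "x \<le> y" for x y
    using DERIV_nonneg_imp_nondecreasing[OF that, of F] F(1) b0 by blast
  have "F 0 < F 1"
    by (rule DERIV_pos_imp_increasing_open[of 0 1 F])
       (use F(1) bpos contF in auto)
  have left: "F x = F 0" if "x \<le> 0" for x
  proof (cases "x = 0")
    case False
    then show ?thesis
      using that b by (intro DERIV_isconst_end[of x 0 F, symmetric] contF) (auto intro: DERIV_cong[OF F(1)])
  qed simp
  have right: "F x = F 1" if "x \<ge> 1" for x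
  proof (cases "x = 1")
    case False
    then show ?thesis
      using that b by (intro DERIV_isconst_end[of 1 x F] contF) (auto intro: DERIV_cong[OF F(1)])
  qed simp
  define S where "S x = (F x - F 0) / (F 1 - F 0)" for x
  have "smooth S"
  proof (rule smooth_antiderivative)
    \<comment> \<open>The argument \<open>1 * x + 0\<close> only serves to match the shape of
      \<open>smooth_affine\<close>.\<close>
    show "(S has_field_derivative (1 / (F 1 - F 0)) * b (1 * x + 0)) (at x)" for x
      unfolding S_def using \<open>F 0 < F 1\<close> F(1)[of x] by (auto intro!: derivative_eq_intros)
    show "smooth (\<lambda>x. (1 / (F 1 - F 0)) * b (1 * x + 0))"
      by (intro smooth_affine) (simp add: b_def smooth_bump_term)
  qed
  moreover have "S x = 0" if "x \<le> 0" for x using left[OF that] by (simp add: S_def)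
  moreover have S1: "S x = 1" if "x \<ge> 1" for x using right[OF that] \<open>F 0 < F 1\<close> by (simp add: S_def)
  moreover have "F 0 \<le> F x" "F x \<le> F 1" for x
    using mono[of 0 x] mono[of x 1] left[of x] right[of x] \<open>F 0 < F 1\<close> by linarith+
  then have "0 \<le> S x" "S x \<le> 1" for x
    using \<open>F 0 < F 1\<close> by (simp_all add: S_def)
  ultimately show thesis using that by blast
qed

text \<open>The ramp is an antiderivative of the step. Combinations of rescaled ramps will be the
  test functions of the du Bois-Reymond lemma, since their derivatives are combinations of steps and
  converge to indicators. The value \<open>R 1\<close> stays unspecified, as it cancels in
  differences.\<close>

lemma ex_smooth_ramp:
  obtains R S where "smooth R" "smooth S" "\<And>x. (R has_field_derivative S x) (at x)"
    "\<And>x. x \<le> 0 \<Longrightarrow> S x = 0" "\<And>x. x \<ge> 1 \<Longrightarrow> S x = 1" "\<And>x. 0 \<le> S x" "\<And>x. S x \<le> (1::real)"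
    "\<And>x. x \<le> 0 \<Longrightarrow> R x = 0" "\<And>x. x \<ge> 1 \<Longrightarrow> R x = x - 1 + R 1"
proof -
  obtain S where S: "smooth S" "\<And>x. x \<le> 0 \<Longrightarrow> S x = 0" "\<And>x. x \<ge> 1 \<Longrightarrow> S x = 1"
    "\<And>x. 0 \<le> S x" "\<And>x. S x \<le> (1::real)" using ex_smooth_step by blast
  obtain F where F: "\<And>x. (F has_field_derivative S x) (at x)" "smooth F"
    using smooth_ex_antiderivative[OF S(1)] by blast
  define R where "R x = F x - F 0" for x
  have R: "(R has_field_derivative S x) (at x)" for x
    unfolding R_def using F(1)[of x] by (auto intro!: derivative_eq_intros)
  have "R x = 0" if "x \<le> 0" for x
  proof (cases "x = 0")
    case False
    then have "R 0 = R x"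
      using that S(2)
      by (intro DERIV_isconst_end[of x 0 R] DERIV_continuous_on[OF has_field_derivative_at_within[OF R]])
         (auto intro: DERIV_cong[OF R])
    then show ?thesis by (simp add: R_def)
  qed (simp add: R_def)
  moreover have "R x = x - 1 + R 1" if "x \<ge> 1" for x
  proof (cases "x = 1")
    case False
    have d: "((\<lambda>x. R x - x) has_field_derivative S x - 1) (at x)" for x
      using R[of x] by (auto intro!: derivative_eq_intros)
    have "R x - x = R 1 - 1"
      using that S(3) False
      by (intro DERIV_isconst_end[of 1 x "\<lambda>x. R x - x"]
            DERIV_continuous_on[OF has_field_derivative_at_within[OF d]])
         (auto intro: DERIV_cong[OF d])
    then show ?thesis by simp
  qed simp
  moreover have "smooth R" using R S(1) smooth_antiderivative by blast
  ultimately show thesis using that[of R S] S R by blast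
qed


section \<open>Weak derivatives as primitives\<close>

lemma continuous_AE_eq:
  fixes f g :: "real \<Rightarrow> real"
  assumes "continuous_on UNIV f" "continuous_on UNIV g" "AE x in lebesgue. f x = g x"
  shows "f x = g x"
proof -
  obtain N where N: "negligible N" "\<And>x. x \<notin> N \<Longrightarrow> f x = g x"
    using AE_lebesgue_negligible[OF assms(3)] by blast
  have "open {x. f x \<noteq> g x}"
    using assms by (intro open_Collect_neq)
  moreover have "negligible {x. f x \<noteq> g x}"
    by (rule negligible_subset[OF N(1)]) (use N(2) in blast)
  ultimately show ?thesis
    using open_not_negligible by blast
qed

section \<open>Null sets, and uniqueness of the integrand of a primitive\<close>

lemma AE_lebesgue_neq: "AE x in lebesgue. x \<noteq> (a::real)"
  by (rule AE_completion) (rule AE_lborel_singleton)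

lemma AE_lebesgue_shift:
  assumes "AE x in lebesgue. P (x::real)"
  shows "AE x in lebesgue. P (x - d)"
proof -
  obtain N where N: "negligible N" "\<And>x. x \<notin> N \<Longrightarrow> P x"
    using AE_lebesgue_negligible[OF assms] by blast
  have "negligible ((+) d ` N)"
    using N(1) by (rule negligible_translation)
  then have "(+) d ` N \<in> null_sets lebesgue"
    by (simp add: negligible_iff_null_sets)
  moreover have "{x \<in> space lebesgue. \<not> P (x - d)} \<subseteq> (+) d ` N"
  proof
    fix x assume "x \<in> {x \<in> space lebesgue. \<not> P (x - d)}"
    then have "x - d \<in> N" using N(2) by blast
    then have "d + (x - d) \<in> (+) d ` N" by (rule imageI)
    then show "x \<in> (+) d ` N" by simp
  qed
  ultimately show ?thesis by (rule AE_I')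
qed

text \<open>Since \<open>ennreal\<close> truncates negative numbers to 0,
  \<open>ennreal (g x)\<close> and \<open>ennreal (- g x)\<close> are the positive and negative
  parts of \<open>g\<close>. Their densities agree and are finite on all half-lines, hence are equal
  as measures. Uniqueness of densities makes the two parts equal almost everywhere, which is
  possible only where \<open>g\<close> is 0.\<close>

lemma lborel_zero_if_Ioi_integrals_zero:
  fixes g :: "real \<Rightarrow> real"
  assumes int: "integrable lborel g" and zero: "\<And>a. (LINT x|lborel. g x * indicator {a<..} x) = 0"
  shows "AE x in lborel. g x = 0"
proof -
  have [measurable]: "g \<in> borel_measurable lborel" using int by blast
  have part: "(\<integral>\<^sup>+x. ennreal (h x) * indicator {a<..} x \<partial>lborel) < \<infinity>"
    if "integrable lborel h" for h and a :: real
  proof -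
    have "(\<integral>\<^sup>+x. ennreal (h x) * indicator {a<..} x \<partial>lborel) \<le> (\<integral>\<^sup>+x. ennreal (norm (h x)) \<partial>lborel)"
      by (intro nn_integral_mono) (auto simp: indicator_def intro: ennreal_leI)
    also have "\<dots> < \<infinity>"
      using that by (simp add: integrable_iff_bounded)
    finally show ?thesis .
  qed
  have eq: "(\<integral>\<^sup>+x. ennreal (g x) * indicator {a<..} x \<partial>lborel)
      = (\<integral>\<^sup>+x. ennreal (- g x) * indicator {a<..} x \<partial>lborel)" (is "?P = ?N") for a
  proof -
    have e: "ennreal (h x * indicator {a<..} x) = ennreal (h x) * indicator {a<..} x" for h and x :: real
      by (simp add: indicator_def)
    have "integrable lborel (\<lambda>x. g x * indicator {a<..} x)"
      using integrable_mult_indicator[of "{a<..}" lborel g] int by (simp add: mult.commute)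
    then have "0 = enn2real ?P - enn2real ?N"
      using zero[of a] real_lebesgue_integral_def[of lborel "\<lambda>x. g x * indicator {a<..} x"]
      by (simp add: e[of g] e[of "\<lambda>x. - g x", simplified])
    moreover have "?P < \<infinity>" "?N < \<infinity>" using part[of g a] part[of "\<lambda>x. - g x" a] int by auto
    ultimately show ?thesis
      by (metis diff_eq_diff_eq cancel_comm_monoid_add_class.diff_cancel ennreal_enn2real infinity_ennreal_def)
  qed
  have "density lborel (\<lambda>x. ennreal (g x)) = density lborel (\<lambda>x. ennreal (- g x))"
  proof (rule measure_eqI_lessThan)
    fix a :: real
    show "emeasure (density lborel (\<lambda>x. ennreal (g x))) {a<..} < \<infinity>"
      using part[OF int, of a] by (simp add: emeasure_density)
    show "emeasure (density lborel (\<lambda>x. ennreal (g x))) {a<..}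
        = emeasure (density lborel (\<lambda>x. ennreal (- g x))) {a<..}"
      using eq by (simp add: emeasure_density)
  qed auto
  moreover have "(\<integral>\<^sup>+x. ennreal (g x) \<partial>lborel) \<noteq> \<infinity>"
  proof -
    have "(\<integral>\<^sup>+x. ennreal (g x) \<partial>lborel) \<le> (\<integral>\<^sup>+x. ennreal (norm (g x)) \<partial>lborel)"
      by (intro nn_integral_mono) (auto intro: ennreal_leI)
    also have "\<dots> < \<infinity>"
      using int by (simp add: integrable_iff_bounded)
    finally show ?thesis by simp
  qed
  ultimately have "AE x in lborel. ennreal (g x) = ennreal (- g x)"
    using finite_density_unique[of "\<lambda>x. ennreal (g x)" lborel "\<lambda>x. ennreal (- g x)"] by simp
  then show ?thesis
  proof eventually_elim
    case (elim x)
    then show ?case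
      by (cases "g x \<ge> 0") (auto simp: ennreal_neg ennreal_eq_0_iff dest: sym)
  qed
qed

text \<open>All integrals of \<open>f\<close> over intervals vanish. Cutting \<open>f\<close> off
  outside \<open>{- real n..real n}\<close> makes it integrable on the line, so the half-line
  criterion applies for each \<open>n\<close>; countably many null sets remain.\<close>

lemma is_primitive_zero_AE:
  assumes "is_primitive (\<lambda>x. k) f"
  shows "AE x in lebesgue. f x = 0"
proof -
  have "AE x in lebesgue. x \<in> {- real n..real n} \<longrightarrow> f x = 0" for n
  proof -
    define h where "h x = indicator {- real n..real n} x * f x" for x
    have li: "f absolutely_integrable_on {a..b}" for a b
      using assms by (simp add: is_primitive_def locally_integrable_iff)
    have h: "integrable lebesgue h"
      using li[of "- real n" "real n"] by (simp add: set_integrable_def h_def[abs_def])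
    \<comment> \<open>The criterion lives on \<open>lborel\<close>, so the Lebesgue measurable
      \<open>h\<close> is exchanged for a Borel function equal to it almost everywhere.\<close>
    obtain g where g: "g \<in> borel_measurable lborel" "AE x in lborel. h x = g x"
      using completion_ex_borel_measurable_real[of h lborel] h by blast
    have hg: "AE x in lebesgue. h x = g x" using g(2) by (rule AE_completion)
    have "g \<in> borel_measurable lebesgue" by (rule measurable_completion[OF g(1)])
    then have "integrable lebesgue g"
      by (rule integrable_cong_AE_imp[OF h _ hg])
    then have "integrable lborel g" using g(1) by (simp add: integrable_completion)
    moreover have "(LINT x|lborel. g x * indicator {a<..} x) = 0" for a
    proof -
      \<comment> \<open>The half-line meets \<open>{- real n..real n}\<close> in an interval with
        left end \<open>m\<close>. Whether \<open>a\<close> itself belongs to it is a matter of a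
        null set, and for \<open>m > real n\<close> the interval is empty.\<close>
      define m where "m = max a (- real n)"
      have "(LINT x|lborel. g x * indicator {a<..} x) = (LINT x|lebesgue. g x * indicator {a<..} x)"
        using g(1) by (intro integral_completion[symmetric]) simp
      also have "\<dots> = (LINT x|lebesgue. indicator {m..real n} x *\<^sub>R f x)"
      proof (rule integral_cong_AE)
        show "AE x in lebesgue. g x * indicator {a<..} x = indicator {m..real n} x *\<^sub>R f x"
          using hg AE_lebesgue_neq[of a]
        proof eventually_elim
          case (elim x)
          then show ?case by (auto simp: h_def m_def indicator_def split: if_splits)
        qed
        show "(\<lambda>x. g x * indicator {a<..} x) \<in> borel_measurable lebesgue"
          using g(1) by (intro measurable_completion) simp
        show "(\<lambda>x. indicator {m..real n} x *\<^sub>R f x) \<in> borel_measurable lebesgue"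
          using li[of m "real n"] unfolding set_integrable_def by blast
      qed
      also have "\<dots> = integral {m..real n} f"
        using set_lebesgue_integral_eq_integral(2)[OF li[of m "real n"]]
        by (simp add: set_lebesgue_integral_def)
      also have "\<dots> = 0"
        using is_primitive_integral[OF assms, of m "real n"] by (cases "m \<le> real n") auto
      finally show ?thesis .
    qed
    ultimately have "AE x in lborel. g x = 0"
      by (rule lborel_zero_if_Ioi_integrals_zero)
    from AE_completion[OF this] hg show ?thesis
      by eventually_elim (auto simp: h_def)
  qed
  then have "AE x in lebesgue. \<forall>n. x \<in> {- real n..real n} \<longrightarrow> f x = 0"
    unfolding AE_all_countable by blast
  then show ?thesis
  proof eventually_elim
    case (elim x)
    obtain n where "\<bar>x\<bar> \<le> real n" using real_arch_simple by blast
    then show ?case using elim by (force simp: abs_le_iff)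
  qed
qed

lemma is_primitive_unique:
  assumes "is_primitive F f" "is_primitive F g"
  shows "AE x in lebesgue. f x = g x"
  using is_primitive_zero_AE[of 0 "\<lambda>x. f x - g x"] is_primitive_diff[OF assms] by simp

section \<open>Test functions and integration by parts\<close>

lemma test_function_support:
  assumes "test_function \<psi>"
  obtains M where "M > 0" "\<And>x. \<bar>x\<bar> \<ge> M \<Longrightarrow> \<psi> x = 0" "\<And>x. \<bar>x\<bar> \<ge> M \<Longrightarrow> deriv \<psi> x = 0"
proof -
  have "bounded {x. \<psi> x \<noteq> 0}"
    using assms bounded_subset[OF compact_imp_bounded closure_subset] by (auto simp: test_function_def)
  then obtain B where B: "\<And>x. \<psi> x \<noteq> 0 \<Longrightarrow> \<bar>x\<bar> \<le> B"
    by (auto simp: bounded_iff)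
  \<comment> \<open>The margin 1 leaves room for an open neighbourhood on which
    \<open>\<psi>\<close> vanishes, so that its derivative vanishes as well.\<close>
  have "deriv \<psi> x = 0" if "\<bar>x\<bar> \<ge> \<bar>B\<bar> + 1" for x
  proof (rule DERIV_imp_deriv)
    have "open {y::real. \<bar>B\<bar> < \<bar>y\<bar>}" by (intro open_Collect_less continuous_intros)
    then show "(\<psi> has_field_derivative 0) (at x)"
      by (rule has_field_derivative_transform_within_open[OF DERIV_const[of 0]])
         (use that B in force)+
  qed
  then show thesis
    using that[of "\<bar>B\<bar> + 1"] B by force
qed

lemma integral_compact_support:
  assumes "locally_integrable f" "continuous_on UNIV \<eta>" "\<And>x. \<bar>x\<bar> \<ge> M \<Longrightarrow> \<eta> x = 0"
  shows "integrable lebesgue (\<lambda>x. f x * \<eta> x)"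
    and "(LINT x|lebesgue. f x * \<eta> x) = integral {-M..M} (\<lambda>x. f x * \<eta> x)"
proof -
  have *: "(\<lambda>x. f x * \<eta> x) absolutely_integrable_on {-M..M}"
    using locally_integrable_continuous_mult[OF assms(1,2)]
    by (simp add: locally_integrable_iff mult.commute)
  have e: "indicator {-M..M} x *\<^sub>R (f x * \<eta> x) = f x * \<eta> x" for x
    using assms(3)[of x] by (cases "\<bar>x\<bar> \<ge> M") (auto simp: indicator_def)
  show "integrable lebesgue (\<lambda>x. f x * \<eta> x)"
    using * unfolding set_integrable_def e .
  show "(LINT x|lebesgue. f x * \<eta> x) = integral {-M..M} (\<lambda>x. f x * \<eta> x)"
    using set_lebesgue_integral_eq_integral(2)[OF *] unfolding set_lebesgue_integral_def e .
qed

lemma test_function_smooth: "test_function \<psi> \<longleftrightarrow> smooth \<psi> \<and> compact (closure {x. \<psi> x \<noteq> 0})"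
  by (simp add: test_function_def smooth_def)

lemma smooth_continuous_on: "smooth f \<Longrightarrow> continuous_on A f"
  by (intro continuous_at_imp_continuous_on ballI) (rule DERIV_isCont[OF smooth_imp_deriv(1)])

lemma continuous_imp_locally_integrable: "continuous_on UNIV f \<Longrightarrow> locally_integrable f"
  unfolding locally_integrable_iff
  by (meson absolutely_integrable_continuous_real continuous_on_subset subset_UNIV)

text \<open>Integration by parts: the product rule for primitives applies to
  \<open>F x * \<psi> x\<close>, which vanishes at both ends of an interval containing the support
  of \<open>\<psi>\<close>.\<close>

lemma is_primitive_imp_weak_deriv:
  assumes F: "is_primitive F g" and f: "AE x in lebesgue. f x = F x"
  shows "is_weak_deriv f g"
  unfolding is_weak_deriv_def
proof (intro conjI allI impI)
  have liF: "locally_integrable F"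
    by (rule continuous_imp_locally_integrable[OF is_primitive_continuous_on[OF F]])
  show "locally_integrable f"
    by (rule locally_integrable_AE_cong[OF liF]) (use f in \<open>simp add: eq_commute\<close>)
  show lig: "locally_integrable g" using F by (simp add: is_primitive_def)
  fix \<psi> assume test: "test_function \<psi>"
  then have sm: "smooth \<psi>" by (simp add: test_function_smooth)
  obtain M where M: "M > 0" "\<And>x. \<bar>x\<bar> \<ge> M \<Longrightarrow> \<psi> x = 0" "\<And>x. \<bar>x\<bar> \<ge> M \<Longrightarrow> deriv \<psi> x = 0"
    using test_function_support[OF test] by blast
  have c: "continuous_on UNIV \<psi>" "continuous_on UNIV (deriv \<psi>)"
    using sm smooth_imp_deriv(2) smooth_continuous_on by auto
  have P: "is_primitive (\<lambda>x. F x * \<psi> x) (\<lambda>x. F x * deriv \<psi> x + g x * \<psi> x)"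
    by (intro is_primitive_mult F is_primitive_if_deriv smooth_imp_deriv(1) sm c)
  have l: "locally_integrable (\<lambda>x. F x * deriv \<psi> x)" "locally_integrable (\<lambda>x. g x * \<psi> x)"
    using locally_integrable_continuous_mult[OF liF c(2)] locally_integrable_continuous_mult[OF lig c(1)]
    by (simp_all add: mult.commute)
  have "(LINT x|lebesgue. f x * deriv \<psi> x) = (LINT x|lebesgue. F x * deriv \<psi> x)"
  proof (rule integral_cong_AE)
    show "(\<lambda>x. F x * deriv \<psi> x) \<in> borel_measurable lebesgue"
      using integral_compact_support(1)[OF liF c(2) M(3)] by blast
    show "(\<lambda>x. f x * deriv \<psi> x) \<in> borel_measurable lebesgue"
      using integral_compact_support(1)[OF \<open>locally_integrable f\<close> c(2) M(3)] by blast
    show "AE x in lebesgue. f x * deriv \<psi> x = F x * deriv \<psi> x"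
      using f by eventually_elim simp
  qed
  also have "\<dots> = integral {-M..M} (\<lambda>x. F x * deriv \<psi> x)"
    by (rule integral_compact_support(2)[OF liF c(2) M(3)])
  also have "\<dots> = - integral {-M..M} (\<lambda>x. g x * \<psi> x)"
  proof -
    have "integral {-M..M} (\<lambda>x. F x * deriv \<psi> x + g x * \<psi> x) = 0"
      using is_primitive_integral[OF P, of "-M" M] M by simp
    then show ?thesis
      using l by (simp add: Henstock_Kurzweil_Integration.integral_add locally_integrable_imp_integrable_on)
  qed
  also have "integral {-M..M} (\<lambda>x. g x * \<psi> x) = (LINT x|lebesgue. g x * \<psi> x)"
    by (rule integral_compact_support(2)[OF lig c(1) M(2), symmetric])
  finally show "(LINT x|lebesgue. f x * deriv \<psi> x) = - (LINT x|lebesgue. g x * \<psi> x)" .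
qed

text \<open>Derivatives of test functions have mean zero. They can be made to converge boundedly to
  the indicator of (a, b] minus \<open>b - a\<close> times the indicator of (0, 1]. In the limit the
  integral of \<open>D\<close> over \<open>{a..b}\<close> is \<open>b - a\<close> times that over
  \<open>{0..1}\<close>, so \<open>D\<close> shares a linear primitive with a constant.\<close>

lemma du_Bois_Reymond:
  assumes li: "locally_integrable D"
    and zero: "\<And>\<psi>. test_function \<psi> \<Longrightarrow> (LINT x|lebesgue. D x * deriv \<psi> x) = 0"
  shows "\<exists>C. AE x in lebesgue. D x = C"
proof -
  obtain R S where RS: "smooth R" "smooth S" "\<And>x. (R has_field_derivative S x) (at x)"
    "\<And>x. x \<le> 0 \<Longrightarrow> S x = 0" "\<And>x. x \<ge> 1 \<Longrightarrow> S x = 1" "\<And>x. 0 \<le> S x" "\<And>x. S x \<le> (1::real)"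
    "\<And>x. x \<le> 0 \<Longrightarrow> R x = 0" "\<And>x. x \<ge> 1 \<Longrightarrow> R x = x - 1 + R 1"
    using ex_smooth_ramp by blast
  \<comment> \<open>At \<open>x = a\<close> the argument is 0 and the step vanishes, so the limit is
    the indicator of the open half-line. \<open>Suc n\<close> keeps the scaling factor at least
    1.\<close>
  have lim: "(\<lambda>n. S (real (Suc n) * x + - (real (Suc n) * a))) \<longlonglongrightarrow> indicator {a<..} x" for x a
  proof (cases "x \<le> a")
    case True
    then have "S (real (Suc n) * x + - (real (Suc n) * a)) = 0" for n
      by (intro RS(4)) (simp add: mult_left_mono)
    then show ?thesis using True by simp
  next
    case False
    then obtain N where "1 / (x - a) \<le> real N" using real_arch_simple by blast
    then have N: "1 \<le> real N * (x - a)" using False by (simp add: field_simps)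
    have "S (real (Suc n) * x + - (real (Suc n) * a)) = 1" if "n \<ge> N" for n
    proof (rule RS(5))
      have "real N * (x - a) \<le> real (Suc n) * (x - a)" using that False by (intro mult_right_mono) auto
      then show "1 \<le> real (Suc n) * x + - (real (Suc n) * a)"
        using N by (simp add: algebra_simps)
    qed
    then show ?thesis
      using False by (intro tendsto_eventually eventually_sequentiallyI[of N]) auto
  qed
  have main: "integral {a..b} D = (b - a) * integral {0..1} D" if "a \<le> b" for a b
  proof -
    \<comment> \<open>Left of the four breakpoints \<open>a\<close>, \<open>b\<close>, 0, 1 every
      ramp vanishes. Right of them the first difference has the constant value \<open>b - a\<close>,
      and so has the second; their difference therefore has compact support.\<close>
    define \<psi> where "\<psi> n = (\<lambda>x. (1 / n * R (n * x + - (n * a)) - 1 / n * R (n * x + - (n * b)))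
      - ((b - a) / n * R (n * x + - (n * 0)) - (b - a) / n * R (n * x + - (n * 1))))" for n
    define \<eta> where "\<eta> n = (\<lambda>x. (S (n * x + - (n * a)) - S (n * x + - (n * b)))
      - ((b - a) * S (n * x + - (n * 0)) - (b - a) * S (n * x + - (n * 1))))" for n
    \<comment> \<open>\<open>M\<close> exceeds each of the four breakpoints by at least 1, so that
      for \<open>n \<ge> 1\<close> the rescaled arguments beyond \<open>M\<close> reach the range
      where the step equals 1.\<close>
    define M where "M = \<bar>a\<bar> + \<bar>b\<bar> + 2"
    have tail: "1 \<le> n * x + - (n * c)" if "n \<ge> 1" "c \<in> {a, b, 0, 1}" "x \<ge> M" for n x c
    proof -
      have "1 \<le> x - c" using that by (auto simp: M_def)
      then have "1 * 1 \<le> n * (x - c)" using that(1) by (intro mult_mono) auto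
      then show ?thesis by (simp add: algebra_simps)
    qed
    have head: "n * x + - (n * c) \<le> 0" if "n \<ge> 1" "c \<in> {a, b, 0, 1}" "x \<le> - M" for n x c
    proof -
      have "x \<le> c" using that by (auto simp: M_def)
      then show ?thesis using that(1) by (simp add: mult_left_mono)
    qed
    have deriv: "(\<psi> n has_field_derivative \<eta> n x) (at x)" if "n \<ge> 1" for n x
    proof -
      have "((\<lambda>x. k / n * R (n * x + - (n * c))) has_field_derivative k * S (n * x + - (n * c))) (at x)" for k c
        using that by (auto intro!: derivative_eq_intros DERIV_chain2[OF RS(3)])
      from DERIV_diff[OF DERIV_diff[OF this[of 1 a] this[of 1 b]]
          DERIV_diff[OF this[of "b - a" 0] this[of "b - a" 1]]]
      show ?thesis by (simp add: \<psi>_def \<eta>_def)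
    qed
    have \<psi>0: "\<psi> n x = 0" if "n \<ge> 1" "\<bar>x\<bar> \<ge> M" for n x
    proof (cases "x \<ge> M")
      case True
      have Rc: "R (n * x + - (n * c)) = n * x + - (n * c) - 1 + R 1" if "c \<in> {a, b, 0, 1}" for c
        by (rule RS(9)[OF tail[OF \<open>n \<ge> 1\<close> that True]])
      have Rs: "R (n * x + - (n * a)) = n * x + - (n * a) - 1 + R 1"
        "R (n * x + - (n * b)) = n * x + - (n * b) - 1 + R 1"
        "R (n * x + - (n * 0)) = n * x + - (n * 0) - 1 + R 1"
        "R (n * x + - (n * 1)) = n * x + - (n * 1) - 1 + R 1"
        by (rule Rc; simp)+
      show ?thesis unfolding \<psi>_def Rs using \<open>n \<ge> 1\<close> by (simp add: field_simps)
    next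
      case False
      then have "x \<le> - M" using that by linarith
      have Rc: "R (n * x + - (n * c)) = 0" if "c \<in> {a, b, 0, 1}" for c
        by (rule RS(8)[OF head[OF \<open>n \<ge> 1\<close> that \<open>x \<le> - M\<close>]])
      have "R (n * x + - (n * a)) = 0" "R (n * x + - (n * b)) = 0"
        "R (n * x + - (n * 0)) = 0" "R (n * x + - (n * 1)) = 0"
        by (rule Rc; simp)+
      then show ?thesis by (simp add: \<psi>_def)
    qed
    have \<eta>0: "\<eta> n x = 0" if "n \<ge> 1" "\<bar>x\<bar> \<ge> M" for n x
    proof (cases "x \<ge> M")
      case True
      have Rc: "S (n * x + - (n * c)) = 1" if "c \<in> {a, b, 0, 1}" for c
        by (rule RS(5)[OF tail[OF \<open>n \<ge> 1\<close> that True]])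
      have "S (n * x + - (n * a)) = 1" "S (n * x + - (n * b)) = 1"
        "S (n * x + - (n * 0)) = 1" "S (n * x + - (n * 1)) = 1"
        by (rule Rc; simp)+
      then show ?thesis by (simp add: \<eta>_def)
    next
      case False
      then have "x \<le> - M" using that by linarith
      have Rc: "S (n * x + - (n * c)) = 0" if "c \<in> {a, b, 0, 1}" for c
        by (rule RS(4)[OF head[OF \<open>n \<ge> 1\<close> that \<open>x \<le> - M\<close>]])
      have "S (n * x + - (n * a)) = 0" "S (n * x + - (n * b)) = 0"
        "S (n * x + - (n * 0)) = 0" "S (n * x + - (n * 1)) = 0"
        by (rule Rc; simp)+
      then show ?thesis by (simp add: \<eta>_def)
    qed
    have sm: "smooth (\<psi> n)" for n
      unfolding \<psi>_def by (intro smooth_diff smooth_affine RS)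
    have c\<eta>: "continuous_on UNIV (\<eta> n)" if "n \<ge> 1" for n
      using smooth_continuous_on[OF smooth_imp_deriv(2)[OF sm]] deriv_eqI[OF deriv[OF that]] by metis
    have test: "test_function (\<psi> n)" if "n \<ge> 1" for n
      unfolding test_function_smooth
    proof (intro conjI sm)
      have "{x. \<psi> n x \<noteq> 0} \<subseteq> {-M..M}" using \<psi>0[OF that] by force
      then have "bounded {x. \<psi> n x \<noteq> 0}" using bounded_closed_interval bounded_subset by blast
      then show "compact (closure {x. \<psi> n x \<noteq> 0})" by (simp add: compact_closure)
    qed
    have null: "(LINT x|lebesgue. D x * \<eta> n x) = 0" if "n \<ge> 1" for n
      using zero[OF test[OF that]] deriv_eqI[OF deriv[OF that]] by simp
    define \<xi> where "\<xi> x = indicator {a<..} x - indicator {b<..} x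
      - ((b - a) * indicator {0<..} x - (b - a) * indicator {1<..} x)" for x :: real
    have "(\<lambda>n. \<eta> (real (Suc n)) x) \<longlonglongrightarrow> \<xi> x" for x
      unfolding \<eta>_def \<xi>_def by (intro tendsto_intros lim)
    then have conv: "(\<lambda>n. D x * \<eta> (real (Suc n)) x) \<longlonglongrightarrow> D x * \<xi> x" for x
      by (intro tendsto_mult_left)
    have int: "integrable lebesgue (\<lambda>x. D x * \<eta> (real (Suc n)) x)" for n
      by (rule integral_compact_support(1)[OF li c\<eta> \<eta>0]) auto
    \<comment> \<open>Two values of the step differ by at most 1, which bounds \<open>\<eta>\<close>
      by \<open>1 + (b - a)\<close> uniformly in \<open>n\<close>; outside \<open>{-M..M}\<close> it
      vanishes.\<close>
    define w where "w x = (1 + (b - a)) * \<bar>indicator {-M..M} x *\<^sub>R D x\<bar>" for x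
    have "integrable lebesgue w"
      using li unfolding w_def locally_integrable_def set_integrable_def by auto
    have bound: "\<bar>D x * \<eta> (real (Suc n)) x\<bar> \<le> w x" for x n
    proof (cases "\<bar>x\<bar> \<ge> M")
      case True
      then show ?thesis using \<eta>0[of "real (Suc n)" x] that by (simp add: w_def)
    next
      case False
      have d: "\<bar>S p - S q\<bar> \<le> 1" for p q using RS(6,7)[of p] RS(6,7)[of q] by linarith
      have "\<bar>\<eta> m x\<bar> \<le> 1 + (b - a)" for m
      proof -
        have "\<bar>(b - a) * (S (m * x + - (m * 0)) - S (m * x + - (m * 1)))\<bar> \<le> (b - a) * 1"
          unfolding abs_mult using that d by (intro mult_mono) auto
        then have "\<bar>(b - a) * (S (m * x + - (m * 0)) - S (m * x + - (m * 1)))\<bar> \<le> b - a" by simp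
        moreover have "\<bar>p - q\<bar> \<le> 1 + (b - a)" if "\<bar>p\<bar> \<le> 1" "\<bar>q\<bar> \<le> b - a" for p q :: real
          using that abs_triangle_ineq4[of p q] by linarith
        ultimately show ?thesis
          using d unfolding \<eta>_def right_diff_distrib[symmetric] by blast
      qed
      then have "\<bar>D x\<bar> * \<bar>\<eta> (real (Suc n)) x\<bar> \<le> \<bar>D x\<bar> * (1 + (b - a))"
        by (intro mult_left_mono) auto
      moreover have "indicator {-M..M} x = (1::real)"
        using False by (auto simp: indicator_def)
      ultimately show ?thesis
        by (simp add: w_def abs_mult mult.commute)
    qed
    have "(\<lambda>x. D x * \<xi> x) \<in> borel_measurable lebesgue"
      by (rule borel_measurable_LIMSEQ_real[OF conv]) (use int in blast)
    then have "(\<lambda>n. LINT x|lebesgue. D x * \<eta> (real (Suc n)) x) \<longlonglongrightarrow> (LINT x|lebesgue. D x * \<xi> x)"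
      using \<open>integrable lebesgue w\<close> int conv bound
      by (intro integral_dominated_convergence[where w = w] AE_I2) (auto simp: integrable_iff_bounded)
    moreover have "(\<lambda>n. LINT x|lebesgue. D x * \<eta> (real (Suc n)) x) = (\<lambda>n. 0)"
      using null by auto
    ultimately have "(LINT x|lebesgue. D x * \<xi> x) = 0"
      by (simp add: LIMSEQ_const_iff)
    moreover have "(LINT x|lebesgue. D x * \<xi> x)
        = (LINT x|lebesgue. indicator {a..b} x *\<^sub>R D x - (b - a) * (indicator {0..1} x *\<^sub>R D x))"
    proof (rule integral_cong_AE)
      \<comment> \<open>The limit lives on half-open intervals; discarding their left ends
        \<open>a\<close> and 0 makes them closed.\<close>
      show "AE x in lebesgue. D x * \<xi> x = indicator {a..b} x *\<^sub>R D x - (b - a) * (indicator {0..1} x *\<^sub>R D x)"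
        using AE_lebesgue_neq[of a] AE_lebesgue_neq[of 0]
      proof eventually_elim
        case (elim x)
        have "indicator {a<..} x - indicator {b<..} x = (indicator {a..b} x :: real)"
          "indicator {0<..} x - indicator {1<..} x = (indicator {0..1} x :: real)"
          using elim that by (auto simp: indicator_def)
        then show ?case unfolding \<xi>_def right_diff_distrib[symmetric] by (simp add: algebra_simps)
      qed
      show "(\<lambda>x. indicator {a..b} x *\<^sub>R D x - (b - a) * (indicator {0..1} x *\<^sub>R D x)) \<in> borel_measurable lebesgue"
        using li unfolding locally_integrable_def set_integrable_def
        by (intro borel_measurable_diff borel_measurable_times borel_measurable_const) blast+
    qed fact
    moreover have "\<dots> = integral {a..b} D - (b - a) * integral {0..1} D"
    proof -
      have i: "set_integrable lebesgue {p..q} D" for p q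
        using li by (simp add: locally_integrable_def)
      show ?thesis
        using i[unfolded set_integrable_def]
        by (simp add: set_lebesgue_integral_eq_integral(2)[OF i, symmetric] set_lebesgue_integral_def)
    qed
    ultimately show ?thesis by simp
  qed
  define C where "C = integral {0..1} D"
  have "is_primitive (\<lambda>x. C * x) D"
    by (rule is_primitiveI[OF li]) (use main in \<open>simp add: C_def algebra_simps\<close>)
  moreover have "is_primitive (\<lambda>x. C * x) (\<lambda>x. C)"
    by (rule is_primitive_if_deriv) (auto intro!: derivative_eq_intros)
  ultimately show ?thesis using is_primitive_unique by blast
qed

text \<open>Any primitive of \<open>g\<close> also has the weak derivative \<open>g\<close>, so
  \<open>f\<close> differs from it by a function with weak derivative 0, which is constant almost
  everywhere by the du Bois-Reymond lemma.\<close>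

lemma weak_deriv_iff_primitive:
  "is_weak_deriv f g \<longleftrightarrow> (\<exists>F. is_primitive F g \<and> (AE x in lebesgue. f x = F x))"
proof
  assume wd: "is_weak_deriv f g"
  then have li: "locally_integrable f" "locally_integrable g" by (auto simp: is_weak_deriv_def)
  obtain I where I: "is_primitive I g" using ex_primitive[OF li(2)] by blast
  have wdI: "is_weak_deriv I g" by (rule is_primitive_imp_weak_deriv[OF I]) simp
  have liI: "locally_integrable I" using wdI by (simp add: is_weak_deriv_def)
  have "locally_integrable (\<lambda>x. f x - I x)"
    using li(1) liI unfolding locally_integrable_def by (auto intro: set_integral_diff)
  moreover have "(LINT x|lebesgue. (f x - I x) * deriv \<psi> x) = 0" if test: "test_function \<psi>" for \<psi>
  proof -
    obtain M where M: "\<And>x. \<bar>x\<bar> \<ge> M \<Longrightarrow> deriv \<psi> x = 0"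
      using test_function_support[OF test] by blast
    have c: "continuous_on UNIV (deriv \<psi>)"
      using test smooth_imp_deriv(2) smooth_continuous_on by (simp add: test_function_smooth)
    have "(LINT x|lebesgue. f x * deriv \<psi> x) = (LINT x|lebesgue. I x * deriv \<psi> x)"
      using wd wdI test by (simp add: is_weak_deriv_def)
    then show ?thesis
      using integral_compact_support(1)[OF li(1) c M] integral_compact_support(1)[OF liI c M]
      by (simp add: left_diff_distrib)
  qed
  ultimately obtain C where C: "AE x in lebesgue. f x - I x = C"
    using du_Bois_Reymond by blast
  have "is_primitive (\<lambda>x. I x + C) g"
    using is_primitive_add[OF I is_primitive_const[of C]] by simp
  moreover have "AE x in lebesgue. f x = I x + C" using C by eventually_elim auto
  ultimately show "\<exists>F. is_primitive F g \<and> (AE x in lebesgue. f x = F x)" by blast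
qed (use is_primitive_imp_weak_deriv in blast)

text \<open>This controls the arbitrary choice in \<open>weak_deriv\<close>: the chosen derivative
  has a primitive that represents \<open>f\<close>, just as \<open>F\<close> does. Two continuous
  representatives coincide, and a common primitive determines its integrand up to a null
  set.\<close>

lemma weak_deriv_AE:
  assumes "is_primitive F g" "AE x in lebesgue. f x = F x"
  shows "AE x in lebesgue. weak_deriv f x = g x"
proof -
  have "is_weak_deriv f (weak_deriv f)"
    unfolding weak_deriv_def by (rule someI[of _ g]) (rule is_primitive_imp_weak_deriv[OF assms])
  then obtain G where G: "is_primitive G (weak_deriv f)" "AE x in lebesgue. f x = G x"
    using weak_deriv_iff_primitive by blast
  have "AE x in lebesgue. F x = G x" using assms(2) G(2) by eventually_elim simp
  then have "F = G"
    using continuous_AE_eq assms(1) G(1) is_primitive_continuous_on by blast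
  then show ?thesis using is_primitive_unique[OF G(1)] assms(1) by simp
qed


section \<open>Square-integrable functions\<close>

lemma Icc_in_lebesgue [simp]: "{a..b::real} \<in> sets lebesgue"
  by (rule sets_completionI_sets) simp

lemma integrable_imp_absolutely_integrable_on:
  fixes q :: "real \<Rightarrow> real"
  shows "integrable lebesgue q \<Longrightarrow> q absolutely_integrable_on {a..b}"
  unfolding set_integrable_def by (rule integrable_mult_indicator) simp_all

lemma L2_AE_cong: "f \<in> L2 \<Longrightarrow> AE x in lebesgue. f x = g x \<Longrightarrow> g \<in> L2"
proof -
  assume "f \<in> L2" and ae: "AE x in lebesgue. f x = g x"
  then have f: "f \<in> borel_measurable lebesgue" "integrable lebesgue (\<lambda>x. (f x)\<^sup>2)"
    by (simp_all add: L2_def)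
  have g: "g \<in> borel_measurable lebesgue"
    by (rule borel_measurable_AE[OF f(1) ae])
  have "AE x in lebesgue. (f x)\<^sup>2 = (g x)\<^sup>2" using ae by eventually_elim simp
  then have "integrable lebesgue (\<lambda>x. (g x)\<^sup>2)"
    by (rule integrable_cong_AE_imp[OF f(2) borel_measurable_power[OF g]])
  with g show "g \<in> L2" by (simp add: L2_def)
qed

lemma L2_cmult:
  assumes "f \<in> L2"
  shows "(\<lambda>x. k * f x) \<in> L2"
proof -
  have "f \<in> borel_measurable lebesgue" "integrable lebesgue (\<lambda>x. (f x)\<^sup>2)"
    using assms by (simp_all add: L2_def)
  then have "(\<lambda>x. k * f x) \<in> borel_measurable lebesgue" "integrable lebesgue (\<lambda>x. k\<^sup>2 * (f x)\<^sup>2)"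
    by (intro borel_measurable_times borel_measurable_const integrable_mult_right, simp_all)
  then show ?thesis
    by (simp add: L2_def power_mult_distrib)
qed

lemma L2_diff:
  assumes "f \<in> L2" "g \<in> L2"
  shows "(\<lambda>x. f x - g x) \<in> L2"
proof -
  have m: "f \<in> borel_measurable lebesgue" "g \<in> borel_measurable lebesgue"
    and i: "integrable lebesgue (\<lambda>x. 2 * ((f x)\<^sup>2 + (g x)\<^sup>2))"
    using assms by (auto simp: L2_def)
  have "integrable lebesgue (\<lambda>x. (f x - g x)\<^sup>2)"
  proof (rule Bochner_Integration.integrable_bound[OF i])
    show "(\<lambda>x. (f x - g x)\<^sup>2) \<in> borel_measurable lebesgue" using m by simp
    have "(p - q)\<^sup>2 \<le> 2 * (p\<^sup>2 + q\<^sup>2)" for p q :: real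
      using zero_le_power2[of "p + q"] by (simp add: power2_eq_square algebra_simps)
    then show "AE x in lebesgue. norm ((f x - g x)\<^sup>2) \<le> norm (2 * ((f x)\<^sup>2 + (g x)\<^sup>2))"
      by (intro AE_I2) simp
  qed
  with m show ?thesis by (simp add: L2_def)
qed

lemma L2_shift:
  assumes "f \<in> L2"
  shows "(\<lambda>x. f (x - d)) \<in> L2"
proof -
  have f: "f \<in> borel_measurable lebesgue" "integrable lebesgue (\<lambda>x. (f x)\<^sup>2)"
    using assms by (auto simp: L2_def)
  have "(\<lambda>x. f (- d + 1 *\<^sub>R x)) \<in> borel_measurable lebesgue"
    by (rule borel_measurable_affine[OF f(1)]) simp
  moreover have "integrable lebesgue (\<lambda>x. (f (- d + 1 * x))\<^sup>2)"
    by (rule lebesgue_integrable_real_affine[OF f(2)]) simp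
  ultimately show ?thesis by (simp add: L2_def)
qed

text \<open>On a bounded interval \<open>\<bar>p\<bar> \<le> 1 + p\<^sup>2\<close> provides an
  integrable majorant.\<close>

lemma L2_locally_integrable:
  assumes "f \<in> L2"
  shows "locally_integrable f"
  unfolding locally_integrable_def set_integrable_def
proof (intro allI)
  fix a b :: real
  have m: "f \<in> borel_measurable lebesgue" and i: "integrable lebesgue (\<lambda>x. (f x)\<^sup>2)"
    using assms by (auto simp: L2_def)
  have "integrable lebesgue (indicator {a..b} :: real \<Rightarrow> real)"
    by (simp add: lmeasurable_iff_integrable[symmetric])
  then have *: "integrable lebesgue (\<lambda>x. indicator {a..b} x + (f x)\<^sup>2)"
    using i by simp
  show "integrable lebesgue (\<lambda>x. indicator {a..b} x *\<^sub>R f x)"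
  proof (rule Bochner_Integration.integrable_bound[OF *])
    show "(\<lambda>x. indicator {a..b} x *\<^sub>R f x) \<in> borel_measurable lebesgue"
      by (intro borel_measurable_scaleR borel_measurable_indicator m) simp
    have "\<bar>p\<bar> \<le> 1 + p\<^sup>2" for p :: real
      using zero_le_power2[of "\<bar>p\<bar> - 1"] zero_le_power2[of p] by (simp add: power2_eq_square algebra_simps)
    then show "AE x in lebesgue. norm (indicator {a..b} x *\<^sub>R f x) \<le> norm (indicator {a..b} x + (f x)\<^sup>2)"
      by (intro AE_I2) (auto simp: indicator_def)
  qed
qed

section \<open>Bounds by the L2 norm and decay at infinity\<close>

lemma integral_le_lebesgue_integral:
  fixes q :: "real \<Rightarrow> real"
  assumes "integrable lebesgue q" "\<And>x. q x \<ge> 0"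
  shows "integral {a..b} q \<le> (LINT x|lebesgue. q x)"
proof -
  have "set_integrable lebesgue {a..b} q"
    by (rule integrable_imp_absolutely_integrable_on[OF assms(1)])
  then have *: "integrable lebesgue (\<lambda>x. indicator {a..b} x *\<^sub>R q x)"
    and "integral {a..b} q = (LINT x|lebesgue. indicator {a..b} x *\<^sub>R q x)"
    by (simp_all add: set_lebesgue_integral_eq_integral(2)[symmetric] set_lebesgue_integral_def set_integrable_def)
  note this(2)
  also have "\<dots> \<le> (LINT x|lebesgue. q x)"
    using assms * by (intro integral_mono) (auto simp: indicator_def)
  finally show ?thesis by simp
qed

text \<open>The constant is not optimal; the bound comes from \<open>\<bar>e\<bar> \<le> r + e\<^sup>2 / r\<close> with \<open>r\<close> slightly larger
  than the norm, which may be zero.\<close>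

lemma integral_abs_le_L2_norm:
  assumes e: "e \<in> L2" and ab: "a \<le> b"
  shows "\<bar>integral {a..b} e\<bar> \<le> (b - a + 1) * L2_norm e"
proof -
  define N where "N = L2_norm e"
  have N: "N \<ge> 0" by (simp add: N_def L2_norm_def)
  have i: "integrable lebesgue (\<lambda>x. (e x)\<^sup>2)" using e by (simp add: L2_def)
  have "(\<lambda>x. (e x)\<^sup>2) absolutely_integrable_on {a..b}"
    by (rule integrable_imp_absolutely_integrable_on[OF i])
  then have i2: "(\<lambda>x. (e x)\<^sup>2) integrable_on {a..b}"
    by (simp add: absolutely_integrable_on_def)
  have i1: "e integrable_on {a..b}"
    by (rule locally_integrable_imp_integrable_on[OF L2_locally_integrable[OF e]])
  have N2: "integral {a..b} (\<lambda>x. (e x)\<^sup>2) \<le> N\<^sup>2"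
    using integral_le_lebesgue_integral[OF i, of a b] by (simp add: N_def L2_norm_def)
  have bound: "\<bar>integral {a..b} e\<bar> \<le> (b - a + 1) * N + (b - a) * \<delta>" if "\<delta> > 0" for \<delta>
  proof -
    have D: "N + \<delta> > 0" using N that by simp
    have "\<bar>e x\<bar> \<le> (N + \<delta>) + (e x)\<^sup>2 / (N + \<delta>)" for x
    proof -
      have "0 \<le> (\<bar>e x\<bar> - (N + \<delta>))\<^sup>2 + (N + \<delta>) * \<bar>e x\<bar>" using D by simp
      then have "(N + \<delta>) * \<bar>e x\<bar> \<le> (N + \<delta>) * (N + \<delta>) + (e x)\<^sup>2"
        by (simp add: power2_diff power2_eq_square algebra_simps)
      then show ?thesis using D by (simp add: field_simps)
    qed
    then have "norm (integral {a..b} e) \<le> integral {a..b} (\<lambda>x. (N + \<delta>) + (e x)\<^sup>2 / (N + \<delta>))"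
      using i1 i2 by (intro integral_norm_bound_integral integrable_add integrable_on_divide) auto
    also have "\<dots> = (b - a) * (N + \<delta>) + integral {a..b} (\<lambda>x. (e x)\<^sup>2) / (N + \<delta>)"
    proof (rule integral_unique)
      have "((\<lambda>x. N + \<delta>) has_integral (b - a) * (N + \<delta>)) {a..b}"
        using has_integral_const_real[of "N + \<delta>" a b] ab by simp
      then show "((\<lambda>x. N + \<delta> + (e x)\<^sup>2 / (N + \<delta>)) has_integral
          (b - a) * (N + \<delta>) + integral {a..b} (\<lambda>x. (e x)\<^sup>2) / (N + \<delta>)) {a..b}"
        using i2 by (intro has_integral_add has_integral_divide integrable_integral)
    qed
    also have "\<dots> \<le> (b - a) * (N + \<delta>) + N"
    proof -
      have "N\<^sup>2 \<le> N * (N + \<delta>)" using N that by (simp add: power2_eq_square algebra_simps)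
      then have "integral {a..b} (\<lambda>x. (e x)\<^sup>2) \<le> N * (N + \<delta>)" using N2 by linarith
      then show ?thesis using D by (simp add: divide_le_eq)
    qed
    finally show ?thesis by (simp add: algebra_simps)
  qed
  show ?thesis
    unfolding N_def[symmetric]
  proof (rule field_le_epsilon)
    fix \<epsilon> :: real assume "\<epsilon> > 0"
    then have "\<epsilon> / (b - a + 1) > 0" "(b - a) * (\<epsilon> / (b - a + 1)) \<le> \<epsilon>"
      using ab by (simp_all add: field_simps)
    then show "\<bar>integral {a..b} e\<bar> \<le> (b - a + 1) * N + \<epsilon>"
      using bound[of "\<epsilon> / (b - a + 1)"] by linarith
  qed
qed

text \<open>Dominated convergence with majorant \<open>q\<close>, applied to the restrictions of
  \<open>q\<close> to the complements of \<open>{- real n..real n}\<close>.\<close>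

lemma integrable_tail:
  fixes q :: "real \<Rightarrow> real"
  assumes q: "integrable lebesgue q" and nonneg: "\<And>x. q x \<ge> 0" and "\<epsilon> > 0"
  shows "\<exists>M. \<forall>a b. {a..b} \<inter> {-M..M} = {} \<longrightarrow> integral {a..b} q < \<epsilon>"
proof -
  let ?t = "\<lambda>n x. indicator (- {- real n..real n}) x *\<^sub>R q x"
  have int: "integrable lebesgue (?t n)" for n
    using q Icc_in_lebesgue by (intro integrable_mult_indicator) (auto simp: sets.compl_sets Compl_eq_Diff_UNIV)
  have "(\<lambda>n. LINT x|lebesgue. ?t n x) \<longlonglongrightarrow> (LINT x::real|lebesgue. (0::real))"
  proof (rule integral_dominated_convergence[where w = q])
    show "AE x in lebesgue. (\<lambda>n. ?t n x) \<longlonglongrightarrow> 0"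
    proof (rule AE_I2)
      fix x
      obtain n where n: "\<bar>x\<bar> \<le> real n" using real_arch_simple by blast
      have "?t m x = 0" if "m \<ge> n" for m
        using n that by (auto simp: indicator_def abs_le_iff)
      then show "(\<lambda>n. ?t n x) \<longlonglongrightarrow> 0"
        by (intro tendsto_eventually eventually_sequentiallyI[of n])
    qed
    show "AE x in lebesgue. norm (?t n x) \<le> q x" for n
      using nonneg by (intro AE_I2) (auto simp: indicator_def)
    show "?t n \<in> borel_measurable lebesgue" for n using int by blast
  qed (use q in auto)
  then have "eventually (\<lambda>n. (LINT x|lebesgue. ?t n x) < \<epsilon>) sequentially"
    using \<open>\<epsilon> > 0\<close> by (intro order_tendstoD(2)[of _ 0]) simp_all
  then obtain n where n: "(LINT x|lebesgue. ?t n x) < \<epsilon>"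
    by (auto simp: eventually_sequentially)
  have "integral {a..b} q < \<epsilon>" if "{a..b} \<inter> {- real n..real n} = {}" for a b
  proof -
    have "integral {a..b} q = integral {a..b} (?t n)"
      using that by (intro Henstock_Kurzweil_Integration.integral_cong) (auto simp: indicator_def)
    also have "\<dots> \<le> (LINT x|lebesgue. ?t n x)"
      using int nonneg by (intro integral_le_lebesgue_integral) auto
    finally show ?thesis using n by simp
  qed
  then show ?thesis by blast
qed

text \<open>The derivative \<open>2 V w\<close> of \<open>V\<^sup>2\<close> is bounded by
  \<open>q = V\<^sup>2 + w\<^sup>2\<close>. Hence \<open>(V x)\<^sup>2\<close> exceeds
  \<open>(V y)\<^sup>2\<close> by at most the integral of \<open>q\<close> over the unit interval to
  the right of \<open>x\<close>, for every \<open>y\<close> in it. Averaging over \<open>y\<close>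
  bounds \<open>(V x)\<^sup>2\<close> by twice that integral, which is small far out.\<close>

lemma L2_primitive_tendsto_zero:
  assumes V: "is_primitive V w" "V \<in> L2" "w \<in> L2"
  shows "(V \<longlongrightarrow> 0) at_infinity"
  unfolding Lim_at_infinity
proof (intro allI impI)
  fix \<epsilon> :: real assume "\<epsilon> > 0"
  define q where "q x = (V x)\<^sup>2 + (w x)\<^sup>2" for x
  have q: "integrable lebesgue q" "\<And>x. q x \<ge> 0"
    using V by (auto simp: q_def[abs_def] L2_def)
  have iq: "q integrable_on {a..b}" for a b
  proof -
    have "q absolutely_integrable_on {a..b}"
      by (rule integrable_imp_absolutely_integrable_on[OF q(1)])
    then show ?thesis by (simp add: absolutely_integrable_on_def)
  qed
  have P: "is_primitive (\<lambda>x. V x * V x) (\<lambda>x. V x * w x + w x * V x)"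
    by (rule is_primitive_mult[OF V(1) V(1)])
  have main: "(V x)\<^sup>2 \<le> 2 * integral {x..x+1} q" for x
  proof -
    have "(V x)\<^sup>2 \<le> (V y)\<^sup>2 + integral {x..x+1} q" if y: "y \<in> {x..x+1}" for y
    proof -
      have "\<bar>integral {x..y} (\<lambda>s. V s * w s + w s * V s)\<bar> \<le> integral {x..y} q"
        unfolding real_norm_def[symmetric]
      proof (rule integral_norm_bound_integral[OF _ iq])
        show "(\<lambda>s. V s * w s + w s * V s) integrable_on {x..y}"
          by (rule locally_integrable_imp_integrable_on) (use P in \<open>simp only: is_primitive_def\<close>)
        fix s
        have "2 * \<bar>V s * w s\<bar> \<le> q s"
          using sum_squares_bound[of "\<bar>V s\<bar>" "\<bar>w s\<bar>"] by (simp add: q_def abs_mult)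
        then show "norm (V s * w s + w s * V s) \<le> q s"
          by (simp add: mult.commute)
      qed
      also have "\<dots> \<le> integral {x..x+1} q"
        using y q(2) iq by (intro integral_subset_le) auto
      finally show ?thesis
        using is_primitive_integral[OF P, of x y] y by (simp add: power2_eq_square)
    qed
    moreover have iV: "(\<lambda>y. (V y)\<^sup>2) integrable_on {x..x+1}"
      by (intro integrable_continuous_interval continuous_intros is_primitive_continuous_on[OF V(1)])
    ultimately have "integral {x..x+1} (\<lambda>y. (V x)\<^sup>2) \<le> integral {x..x+1} (\<lambda>y. (V y)\<^sup>2 + integral {x..x+1} q)"
      by (intro integral_le integrable_add) auto
    moreover have "integral {x..x+1} (\<lambda>y. (V y)\<^sup>2 + integral {x..x+1} q)
        = integral {x..x+1} (\<lambda>y. (V y)\<^sup>2) + integral {x..x+1} q"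
      using has_integral_add[OF integrable_integral[OF iV] has_integral_const_real[of "integral {x..x+1} q" x "x+1"]]
      by (simp add: integral_unique)
    ultimately have "(V x)\<^sup>2 \<le> integral {x..x+1} (\<lambda>y. (V y)\<^sup>2) + integral {x..x+1} q"
      by simp
    moreover have "integral {x..x+1} (\<lambda>y. (V y)\<^sup>2) \<le> integral {x..x+1} q"
      using iV iq by (intro integral_le) (auto simp: q_def)
    ultimately show ?thesis by linarith
  qed
  obtain M where M: "\<And>a b. {a..b} \<inter> {-M..M} = {} \<Longrightarrow> integral {a..b} q < \<epsilon>\<^sup>2 / 2"
    using integrable_tail[OF q, of "\<epsilon>\<^sup>2 / 2"] zero_less_power[OF \<open>\<epsilon> > 0\<close>, of 2] half_gt_zero by blast
  show "\<exists>b. \<forall>x. b \<le> norm x \<longrightarrow> dist (V x) 0 < \<epsilon>"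
  \<comment> \<open>The margin 2 makes \<open>{x..x+1}\<close> miss \<open>{-M..M}\<close> for
    negative \<open>x\<close> too, where the right end \<open>x + 1\<close> is the critical
    one.\<close>
  proof (intro exI[of _ "\<bar>M\<bar> + 2"] allI impI)
    fix x :: real assume "\<bar>M\<bar> + 2 \<le> norm x"
    then have "{x..x+1} \<inter> {-M..M} = {}" by auto
    then have "integral {x..x+1} q < \<epsilon>\<^sup>2 / 2" by (rule M)
    then have "\<bar>V x\<bar>\<^sup>2 < \<epsilon>\<^sup>2" using main[of x] by simp
    then have "\<bar>V x\<bar> < \<epsilon>"
      using \<open>\<epsilon> > 0\<close> by (intro power2_less_imp_less[of "\<bar>V x\<bar>" \<epsilon>]) simp_all
    then show "dist (V x) 0 < \<epsilon>" by simp
  qed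
qed

section \<open>The time derivative of a translated profile\<close>

lemma sobolev_norm_0: "sobolev_norm 0 f = L2_norm f"
  by (simp add: sobolev_norm_def L2_norm_def)

text \<open>The L2 limit \<open>v\<close> is given, so only its integrals over intervals need
  computing. Integration over \<open>{a..b}\<close> is continuous in the L2 norm, and the integral
  of a translate of \<open>H\<close> depends on time through an antiderivative of the continuous
  function \<open>H\<close>, which is classically differentiable.\<close>

lemma translation_time_derivative:
  assumes H: "is_primitive H h" "H \<in> L2"
    and m: "\<And>s. s \<ge> 0 \<Longrightarrow> AE x in lebesgue. m s x = H (x - c * s)"
    and v: "has_time_deriv 0 m v t" and t: "t > 0"
  shows "is_primitive (\<lambda>x. - c * H (x - c * t)) v"
proof (rule is_primitiveI)
  have vL: "v \<in> L2" using v by (simp add: has_time_deriv_def)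
  then show liv: "locally_integrable v" by (rule L2_locally_integrable)
  fix a b :: real assume ab: "a \<le> b"
  let ?W = "at t within {0..}"
  have "t \<in> interior {0..}" using t by simp
  \<comment> \<open>At an interior time the one-sided filter is the full one, which the uniqueness
    of limits and the pointwise derivative of \<open>Q\<close> below are stated for.\<close>
  then have W: "?W = at t" by (rule at_within_interior)
  \<comment> \<open>This is the error of the difference quotient with \<open>m\<close> replaced by
    translates of its continuous representative; for \<open>s \<ge> 0\<close> the L2 norm is
    unchanged.\<close>
  define e where "e s x = (H (x - c * s) - H (x - c * t)) / (s - t) - v x" for s x
  have eL: "e s \<in> L2" for s
    using L2_diff[OF L2_cmult[OF L2_diff[OF L2_shift[OF H(2), of "c * s"] L2_shift[OF H(2), of "c * t"]],
        of "1 / (s - t)"] vL]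
    by (simp add: e_def[abs_def])
  have norm_eq: "sobolev_norm 0 (\<lambda>x. (m s x - m t x) / (s - t) - v x) = L2_norm (e s)" if "s \<ge> 0" for s
  proof -
    have ae: "AE x in lebesgue. e s x = (m s x - m t x) / (s - t) - v x"
      using m[OF that] m[OF less_imp_le[OF t]] by eventually_elim (simp add: e_def)
    have "(\<lambda>x. (m s x - m t x) / (s - t) - v x) \<in> L2"
      by (rule L2_AE_cong[OF eL ae])
    then have "(LINT x|lebesgue. ((m s x - m t x) / (s - t) - v x)\<^sup>2) = (LINT x|lebesgue. (e s x)\<^sup>2)"
      using ae eL[of s] by (intro integral_cong_AE) (auto simp: L2_def)
    then show ?thesis by (simp add: sobolev_norm_0 L2_norm_def)
  qed
  have "((\<lambda>s. sobolev_norm 0 (\<lambda>x. (m s x - m t x) / (s - t) - v x)) \<longlongrightarrow> 0) ?W"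
    using v by (simp add: has_time_deriv_def)
  then have "((\<lambda>s. L2_norm (e s)) \<longlongrightarrow> 0) ?W"
    by (rule Lim_transform_eventually) (use norm_eq in \<open>auto simp: eventually_at_filter\<close>)
  then have "((\<lambda>s. (b - a + 1) * L2_norm (e s)) \<longlongrightarrow> 0) ?W"
    by (rule tendsto_mult_right_zero)
  then have lim0: "((\<lambda>s. integral {a..b} (e s)) \<longlongrightarrow> 0) (at t)"
    unfolding W by (rule Lim_null_comparison[rotated]) (use integral_abs_le_L2_norm[OF eL ab] in simp)
  obtain P where P: "\<And>x. (P has_field_derivative H x) (at x)"
    using continuous_ex_antiderivative[of H] is_primitive_isCont[OF H(1)] by blast
  have PH: "is_primitive P H"
    using P is_primitive_continuous_on[OF H(1)] by (rule is_primitive_if_deriv)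
  \<comment> \<open>\<open>Q s\<close> is the integral of the translate of \<open>H\<close> at time
    \<open>s\<close> over \<open>{a..b}\<close>.\<close>
  define Q where "Q s = P (b - c * s) - P (a - c * s)" for s
  have "(Q has_field_derivative - c * (H (b - c * t) - H (a - c * t))) (at t)"
    unfolding Q_def by (auto intro!: derivative_eq_intros DERIV_chain2[OF P] simp: algebra_simps)
  then have "((\<lambda>s. (Q s - Q t) / (s - t)) \<longlongrightarrow> - c * (H (b - c * t) - H (a - c * t))) (at t)"
    by (simp add: has_field_derivative_iff)
  then have "((\<lambda>s. (Q s - Q t) / (s - t) - integral {a..b} v)
      \<longlongrightarrow> - c * (H (b - c * t) - H (a - c * t)) - integral {a..b} v) (at t)"
    by (intro tendsto_intros)
  moreover have "integral {a..b} (e s) = (Q s - Q t) / (s - t) - integral {a..b} v" for s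
  proof -
    have hs: "((\<lambda>x. H (x - c * s)) has_integral Q s) {a..b}" for s
      using is_primitive_shift[OF PH, of "c * s"] ab by (simp add: is_primitive_def Q_def)
    have "(e s has_integral (Q s - Q t) / (s - t) - integral {a..b} v) {a..b}"
      unfolding e_def
      by (intro has_integral_diff has_integral_divide hs integrable_integral
          locally_integrable_imp_integrable_on liv)
    then show ?thesis by (rule integral_unique)
  qed
  ultimately have "((\<lambda>s. integral {a..b} (e s))
      \<longlongrightarrow> - c * (H (b - c * t) - H (a - c * t)) - integral {a..b} v) (at t)"
    by simp
  from tendsto_unique[OF _ lim0 this]
  have "0 = - c * (H (b - c * t) - H (a - c * t)) - integral {a..b} v"
    by simp
  then show "integral {a..b} v = - c * H (b - c * t) - - c * H (a - c * t)"
    by (simp add: algebra_simps)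
qed

section \<open>Travelling waves\<close>

lemma zero_if_travelling_equation:
  assumes p: "is_primitive V V1" "is_primitive V1 V2" "is_primitive V2 g"
    and L: "V \<in> L2" "V1 \<in> L2" "V2 \<in> L2"
    and eq: "\<And>x. ((V x)\<^sup>2 - (V1 x)\<^sup>2 - c) * (V x - V2 x) = K"
  shows "V x = 0"
proof (rule ccontr)
  assume V0: "V x \<noteq> 0"
  define G where "G x = (V x)\<^sup>2 - (V1 x)\<^sup>2" for x
  have cont: "continuous_on A V" "continuous_on A V1" "continuous_on A V2" for A
    using p is_primitive_continuous_on by auto
  have dV: "(V has_field_derivative V1 x) (at x)" "(V1 has_field_derivative V2 x) (at x)" for x
    using is_primitive_deriv[OF p(1) cont(2)] is_primitive_deriv[OF p(2) cont(3)] by auto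
  have cG: "continuous_on A G" for A unfolding G_def by (intro continuous_intros cont)
  have lim: "(V \<longlongrightarrow> 0) at_infinity" "(V1 \<longlongrightarrow> 0) at_infinity"
    using L2_primitive_tendsto_zero p L by auto
  then have limG: "(G \<longlongrightarrow> 0) at_infinity"
    unfolding G_def by (auto intro!: tendsto_eq_intros)
  \<comment> \<open>Near infinity \<open>\<bar>G x - c\<bar>\<close> is at most
    \<open>B = 1 + \<bar>c\<bar>\<close>, so \<open>K \<noteq> 0\<close> would keep
    \<open>\<bar>V x - V2 x\<bar>\<close> above \<open>\<bar>K\<bar> / B\<close> there. Unit
    intervals far out then contradict the square integrability of \<open>V - V2\<close>.\<close>
  have "K = 0"
  proof (rule ccontr)
    assume "K \<noteq> 0"
    have "eventually (\<lambda>x. \<bar>G x\<bar> < 1) at_infinity"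
      using tendsto_rabs_zero[OF limG] by (rule order_tendstoD) simp
    then obtain b where b: "\<And>x. \<bar>x\<bar> \<ge> b \<Longrightarrow> \<bar>G x\<bar> < 1"
      by (auto simp: eventually_at_infinity)
    define B where "B = 1 + \<bar>c\<bar>"
    have "B > 0" by (simp add: B_def)
    have "(\<lambda>x. V x - V2 x) \<in> L2" by (intro L2_diff L)
    then have q: "integrable lebesgue (\<lambda>x. (V x - V2 x)\<^sup>2)" by (simp add: L2_def)
    have low: "(\<bar>K\<bar> / B)\<^sup>2 \<le> (V x - V2 x)\<^sup>2" if "\<bar>x\<bar> \<ge> b" for x
    proof -
      have "\<bar>G x - c\<bar> \<le> B" using b[OF that] by (simp add: B_def)
      then have "\<bar>G x - c\<bar> * \<bar>V x - V2 x\<bar> \<le> B * \<bar>V x - V2 x\<bar>" by (rule mult_right_mono) simp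
      moreover have "\<bar>K\<bar> = \<bar>G x - c\<bar> * \<bar>V x - V2 x\<bar>"
        using eq[of x] by (simp add: G_def abs_mult[symmetric])
      ultimately have "\<bar>K\<bar> / B \<le> \<bar>V x - V2 x\<bar>" using \<open>B > 0\<close> by (simp add: divide_le_eq mult.commute)
      then have "(\<bar>K\<bar> / B)\<^sup>2 \<le> \<bar>V x - V2 x\<bar>\<^sup>2" using \<open>B > 0\<close> by (intro power_mono) auto
      then show ?thesis by simp
    qed
    have "(\<bar>K\<bar> / B)\<^sup>2 > 0" using \<open>K \<noteq> 0\<close> \<open>B > 0\<close> by simp
    from integrable_tail[OF q _ this] obtain M where
      M: "\<And>s t. {s..t} \<inter> {-M..M} = {} \<Longrightarrow> integral {s..t} (\<lambda>x. (V x - V2 x)\<^sup>2) < (\<bar>K\<bar> / B)\<^sup>2"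
      by auto
    define s where "s = \<bar>M\<bar> + \<bar>b\<bar> + 1"
    have "integral {s..s+1} (\<lambda>x. (\<bar>K\<bar> / B)\<^sup>2) \<le> integral {s..s+1} (\<lambda>x. (V x - V2 x)\<^sup>2)"
      by (intro integral_le integrable_continuous_interval continuous_intros cont low) (auto simp: s_def)
    moreover have "{s..s+1} \<inter> {-M..M} = {}" by (auto simp: s_def)
    ultimately show False using M[of s "s+1"] by simp
  qed
  have "((\<lambda>x. (G x - c)\<^sup>2) has_field_derivative 0) (at x)" for x
  proof -
    have "((\<lambda>x. (G x - c)\<^sup>2) has_field_derivative
        2 * (G x - c) * (2 * V x * V1 x - 2 * V1 x * V2 x)) (at x)"
      unfolding G_def using dV[of x]
      by (auto intro!: derivative_eq_intros simp: power2_eq_square algebra_simps)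
    moreover have "2 * (G x - c) * (2 * V x * V1 x - 2 * V1 x * V2 x)
        = 4 * V1 x * ((G x - c) * (V x - V2 x))"
      by (simp add: algebra_simps)
    moreover have "(G x - c) * (V x - V2 x) = 0" using eq[of x] \<open>K = 0\<close> unfolding G_def by simp
    ultimately show ?thesis by (simp only: mult_zero_right)
  qed
  then obtain k where k: "\<And>x. (G x - c)\<^sup>2 = k"
    using DERIV_isconst_all by metis
  have "((\<lambda>x. (G x - c)\<^sup>2) \<longlongrightarrow> (0 - c)\<^sup>2) at_infinity"
    by (intro tendsto_intros limG)
  then have "k = c\<^sup>2"
    by (simp add: k tendsto_const_iff trivial_limit_at_infinity)
  have V1at: "V1 y = 0" if max: "\<And>z. (V z)\<^sup>2 \<le> (V y)\<^sup>2" and "V y \<noteq> 0" for y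
  proof -
    have "((\<lambda>z. (V z)\<^sup>2) has_field_derivative 2 * V y * V1 y) (at y)"
      using dV[of y] by (auto intro!: derivative_eq_intros)
    then have "2 * V y * V1 y = 0"
      by (rule DERIV_local_max[of _ _ _ 1]) (use max in auto)
    then show ?thesis using \<open>V y \<noteq> 0\<close> by simp
  qed
  \<comment> \<open>Since \<open>V\<close> decays, \<open>V\<^sup>2\<close> stays below its positive
    value at \<open>x\<close> outside some \<open>{-b..b}\<close>; the maximum over this compact
    interval is therefore global.\<close>
  obtain y where y: "\<And>z. (V z)\<^sup>2 \<le> (V y)\<^sup>2"
  proof -
    have "((\<lambda>z. (V z)\<^sup>2) \<longlongrightarrow> 0) at_infinity"
      using tendsto_power[OF lim(1), of 2] by simp
    then have "eventually (\<lambda>z. (V z)\<^sup>2 < (V x)\<^sup>2) at_infinity"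
      using V0 by (intro order_tendstoD(2)[of _ 0]) auto
    then obtain b where b: "\<And>z. \<bar>z\<bar> \<ge> b \<Longrightarrow> (V z)\<^sup>2 < (V x)\<^sup>2"
      by (auto simp: eventually_at_infinity)
    have "\<not> b \<le> \<bar>x\<bar>" using b[of x] by blast
    then have xb: "x \<in> {-b..b}" by auto
    have "\<exists>y\<in>{-b..b}. \<forall>z\<in>{-b..b}. (V z)\<^sup>2 \<le> (V y)\<^sup>2"
      using xb by (intro continuous_attains_sup continuous_intros cont) auto
    then obtain y where y: "y \<in> {-b..b}" "\<And>z. z \<in> {-b..b} \<Longrightarrow> (V z)\<^sup>2 \<le> (V y)\<^sup>2" by blast
    have "(V z)\<^sup>2 \<le> (V y)\<^sup>2" for z
    proof (cases "z \<in> {-b..b}")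
      case False
      then have "\<bar>z\<bar> \<ge> b" by auto
      then show ?thesis using b[of z] y(2)[OF xb] by linarith
    qed (rule y(2))
    then show thesis using that by blast
  qed
  have "(V y)\<^sup>2 > 0" using y[of x] V0 by (smt (verit) zero_less_power2)
  then have "G y > 0" using V1at[OF y] by (auto simp: G_def)
  have "(G y - c)\<^sup>2 = c\<^sup>2" using k \<open>k = c\<^sup>2\<close> by simp
  then have "G y * (G y - 2 * c) = 0" by (simp add: power2_eq_square algebra_simps)
  then have Gy: "G y = 2 * c" using \<open>G y > 0\<close> by simp
  then have "c > 0" using \<open>G y > 0\<close> by simp
  have "eventually (\<lambda>z. G z < c) at_infinity"
    using limG \<open>c > 0\<close> by (rule order_tendstoD)
  then obtain b where b: "\<And>z. \<bar>z\<bar> \<ge> b \<Longrightarrow> G z < c"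
    by (auto simp: eventually_at_infinity)
  \<comment> \<open>Far to the right \<open>G\<close> is below \<open>c\<close>, whereas at
    \<open>y\<close> it is \<open>2 * c\<close>. Where \<open>G\<close> crosses \<open>c\<close>,
    the constant \<open>(G z - c)\<^sup>2\<close> would be 0 instead of
    \<open>c\<^sup>2\<close>.\<close>
  have "G (max y \<bar>b\<bar>) < c" by (rule b) (auto simp: max_def)
  then have "\<exists>z\<ge>y. z \<le> max y \<bar>b\<bar> \<and> G z = c"
    using Gy \<open>c > 0\<close> by (intro IVT2' cG) auto
  then obtain z where "G z = c" by blast
  then show False using k[of z] \<open>k = c\<^sup>2\<close> \<open>c > 0\<close> by simp
qed

text \<open>Sobolev functions matter only up to null sets, so the first conjunct states triviality
  of the class of \<open>\<phi>\<close>; the second yields the pointwise statement for a smooth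
  profile.\<close>

theorem theorem6p1:
  fixes \<phi> :: "real \<Rightarrow> real" and c :: real and u :: "real \<Rightarrow> real \<Rightarrow> real"
  assumes travelling: "\<And>t x. t \<ge> 0 \<Longrightarrow> u t x = \<phi> (x - c * t)"
    and regular: "u \<in> C0_sobolev 3 \<inter> C1_sobolev 2"
    and solution: "solves_equation u"
  shows "(AE x in lebesgue. \<phi> x = 0) \<and> (continuous_on UNIV \<phi> \<longrightarrow> (\<forall>x. \<phi> x = 0))"
proof -
  have "u 0 \<in> sobolev 3" using regular by (simp add: C0_sobolev_def)
  moreover have "u 0 = \<phi>" using travelling[of 0] by auto
  ultimately have "\<phi> \<in> sobolev (Suc (Suc (Suc 0)))" by (simp add: numeral_3_eq_3)
  then obtain g1 g2 g3 where g: "\<phi> \<in> L2" "g1 \<in> L2" "g2 \<in> L2" "g3 \<in> L2"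
    "is_weak_deriv \<phi> g1" "is_weak_deriv g1 g2" "is_weak_deriv g2 g3"
    by auto
  obtain V where V: "is_primitive V g1" "AE x in lebesgue. \<phi> x = V x"
    using g(5) weak_deriv_iff_primitive by blast
  obtain V1 where V1: "is_primitive V1 g2" "AE x in lebesgue. g1 x = V1 x"
    using g(6) weak_deriv_iff_primitive by blast
  obtain V2 where V2: "is_primitive V2 g3" "AE x in lebesgue. g2 x = V2 x"
    using g(7) weak_deriv_iff_primitive by blast
  \<comment> \<open>Integrands may be changed on null sets. Hence \<open>V\<close> is a primitive of
    the continuous \<open>V1\<close>, and \<open>V1\<close> of the continuous \<open>V2\<close>;
    only \<open>g3\<close> remains without a continuous representative.\<close>
  have p: "is_primitive V V1" "is_primitive V1 V2"
    using is_primitive_AE_cong V V1 V2 by blast+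
  have L: "V \<in> L2" "V1 \<in> L2" "V2 \<in> L2"
    using L2_AE_cong g V V1 V2 by blast+
  define H where "H x = V x - V2 x" for x
  define h where "h x = V1 x - g3 x" for x
  have H: "is_primitive H h" "H \<in> L2"
    unfolding H_def h_def by (intro is_primitive_diff p V2 L2_diff L)+
  have uV: "AE x in lebesgue. u s x = V (x - c * s)" if "s \<ge> 0" for s
    using AE_lebesgue_shift[OF V(2)] travelling[OF that] by simp
  have ux: "AE x in lebesgue. weak_deriv (u s) x = V1 (x - c * s)" if "s \<ge> 0" for s
    by (rule weak_deriv_AE[OF is_primitive_shift[OF p(1)] uV[OF that]])
  have uxx: "AE x in lebesgue. weak_deriv (weak_deriv (u s)) x = V2 (x - c * s)" if "s \<ge> 0" for s
    by (rule weak_deriv_AE[OF is_primitive_shift[OF p(2)] ux[OF that]])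
  have mH: "AE x in lebesgue. momentum u s x = H (x - c * s)" if "s \<ge> 0" for s
    using uV[OF that] uxx[OF that] by eventually_elim (simp add: momentum_def H_def)
  have mx: "AE x in lebesgue. weak_deriv (momentum u s) x = h (x - c * s)" if "s \<ge> 0" for s
    by (rule weak_deriv_AE[OF is_primitive_shift[OF H(1)] mH[OF that]])
  \<comment> \<open>One positive time suffices, because the profile only moves; the translation by
    \<open>c\<close> at time 1 is undone at the end.\<close>
  obtain v where v: "has_time_deriv 0 (momentum u) v 1"
    "AE x in lebesgue. v x + ((u 1 x)\<^sup>2 - (weak_deriv (u 1) x)\<^sup>2) * weak_deriv (momentum u 1) x
        + 2 * weak_deriv (u 1) x * (momentum u 1 x)\<^sup>2 = 0"
    using solution unfolding solves_equation_def by (meson zero_less_one)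
  have Pv: "is_primitive (\<lambda>x. - c * H (x - c)) v"
    using translation_time_derivative[OF H mH v(1)] by simp
  define G where "G x = V x * V x - V1 x * V1 x" for x
  define G' where "G' x = (V x * V1 x + V1 x * V x) - (V1 x * V2 x + V2 x * V1 x)" for x
  have "is_primitive G G'"
    unfolding G_def G'_def
    by (rule is_primitive_diff[OF is_primitive_mult[OF p(1) p(1)] is_primitive_mult[OF p(2) p(2)]])
  from is_primitive_add[OF Pv is_primitive_shift[OF is_primitive_mult[OF this H(1)], of c]]
  have const: "is_primitive (\<lambda>x. - c * H (x - c) + G (x - c) * H (x - c)) (\<lambda>x. 0)"
  proof (rule is_primitive_AE_cong)
    \<comment> \<open>\<open>G' = 2 V1 H\<close>, so the nonlinear terms of the equation are the
      derivative of \<open>G H\<close>. With \<open>v\<close> as the derivative of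
      \<open>- c H\<close>, the equation says that the whole integrand vanishes almost
      everywhere.\<close>
    have Geq: "(G (x - c) * h (x - c) + G' (x - c) * H (x - c))
        = ((V (x - c))\<^sup>2 - (V1 (x - c))\<^sup>2) * h (x - c) + 2 * V1 (x - c) * (H (x - c))\<^sup>2" for x
      by (simp add: G_def G'_def H_def power2_eq_square algebra_simps)
    show "AE x in lebesgue. v x + (G (x - c) * h (x - c) + G' (x - c) * H (x - c)) = 0"
      using v(2) uV[of 1, simplified] ux[of 1, simplified] mH[of 1, simplified] mx[of 1, simplified]
      by eventually_elim (simp add: Geq add.assoc)
  qed
  have "(- c * H (x - c) + G (x - c) * H (x - c)) = (- c * H (y - c) + G (y - c) * H (y - c))" if "x \<le> y" for x y
    using is_primitive_integral[OF const that] by simp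
  then have "(- c * H (x - c) + G (x - c) * H (x - c)) = (- c * H (0 - c) + G (0 - c) * H (0 - c))" for x
    by (metis linear)
  from this[of "_ + c"]
  have "((V x)\<^sup>2 - (V1 x)\<^sup>2 - c) * (V x - V2 x) = - c * H (0 - c) + G (0 - c) * H (0 - c)" for x
    by (simp add: G_def H_def power2_eq_square algebra_simps)
  then have zero: "V x = 0" for x
    by (rule zero_if_travelling_equation[OF p V2(1) L])
  then have ae: "AE x in lebesgue. \<phi> x = 0" using V(2) by simp
  moreover have "\<forall>x. \<phi> x = 0" if "continuous_on UNIV \<phi>"
    using continuous_AE_eq[OF that continuous_on_const ae] by blast
  ultimately show ?thesis by blast
qed


end
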